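(* Let $G=(V,E,w)$ be a connected hypergraph with $V=\{v_1,\dots,v_{n+m}\}$ and let $p\in[1,\infty)$. Let $a=(0,\dots,0,a_1,\dots,a_m)$ (first $n$ components zero) and $h$ satisfy $$a\in W^{1,2}_{\mathrm{loc}}(0,\infty;\mathbb{R}^V),\quad h\in L^2_{\mathrm{loc}}(0,\infty;\mathbb{R}^V),\quad a',h'\in L^1(0,\infty;\mathbb{R}^V),\quad h\in L^1(0,\infty;\mathbb{R}^V)\cap L^2(0,\infty;\mathbb{R}^V),$$ let $x_0\in K_a(0)$, and let $x$ be the unique global solution to $$x'(t)+\partial\varphi(x(t))+\partial I_{K_a(t)}(x(t))\ni h(t)\quad(t\in[0,\infty)),\qquad x(0)=x_0 .$$ If $a\in L^p(0,\infty;\mathbb{R}^V)$ and $a'\in L^2(0,\infty;\mathbb{R}^V)$, then $x(t)\to0$ as $t\to\infty$. In particular, if $h=a\equiv0$, then there exists a constant $\gamma>0$ depending only on $p$ and $G$ (hence not on $x_0$) such that, for all $t\ge0$, $$\|x(t)\|\le\begin{cases}\big(\|x_0\|^{2-p}-\gamma t\big)_+^{\frac1{2-p}} & \text{if }1\le p<2,\\[1mm] \|x_0\|\exp(-\gamma t) & \text{if }p=2,\\[1mm] \big(\|x_0\|^{-(p-2)}+\gamma t\big)^{-\frac1{p-2}} & \text{if }p>2,\end{cases}$$ where $(s)_+=\max\{0,s\}$.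
   Context: Hypergraph: $n,m\ge 1$ are integers, $V=\{v_1,\dots,v_n,v_{n+1},\dots,v_{n+m}\}$ is a finite set with $n+m$ elements, $E\subset 2^V$ is a family of subsets of $V$ each having at least two elements, and $w:E\to(0,\infty)$. The triplet $G=(V,E,w)$ is called a hypergraph. $G$ is connected if for all $u,v\in V$ there exist $u_1,\dots,u_{N-1}\in V$ and $e_1,\dots,e_N\in E$ with $u_{j-1},u_j\in e_j$ for $j=1,\dots,N$, where $u_0=u$, $u_N=v$. $\mathbb{R}^V$ is the set of maps $x:V\to\mathbb{R}$, identified with $\mathbb{R}^{n+m}$ via $x_i=x(v_i)$, with standard inner product $x\cdot y$ and Euclidean norm $\|x\|$. Energy: $f_e(x)=\max_{u,v\in e}(x(u)-x(v))$ for $e\in E$, and $\varphi(x)=\frac1p\sum_{e\in E}w(e)(f_e(x))^p$. Subdifferential: for a proper lower semicontinuous convex $\psi:\mathbb{R}^V\to(-\infty,+\infty]$, $\partial\psi(x)=\{\eta\in\mathbb{R}^V:\ \eta\cdot(z-x)\le\psi(z)-\psi(x)\ \forall z\in\mathbb{R}^V\}$ if $\psi(x)<\infty$, and $\partial\psi(x)=\varnothing$ otherwise. Constraint: $K_a(t)=\{x\in\mathbb{R}^V:\ x=(x_1,\dots,x_n,a_1(t),\dots,a_m(t)),\ x_i\in\mathbb{R}\ (i=1,\dots,n)\}$, and $I_{K_a(t)}$ is its indicator function ($0$ on $K_a(t)$, $+\infty$ elsewhere). Function spaces: $W^{1,2}(0,T;\mathbb{R}^V)$ is the set of functions that belong to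 $L^2(0,T;\mathbb{R}^V)$ together with their derivative; elements are identified with their (absolutely) continuous representatives on $[0,T]$. $W^{1,2}_{\mathrm{loc}}(0,\infty;\mathbb{R}^V)$ and $L^2_{\mathrm{loc}}(0,\infty;\mathbb{R}^V)$ denote functions on $[0,\infty)$ whose restriction to $(0,T)$ belongs to $W^{1,2}(0,T;\mathbb{R}^V)$, respectively $L^2(0,T;\mathbb{R}^V)$, for every $T\in(0,\infty)$; $h'$ is the (weak) derivative of $h$. A global solution is a function $x\in W^{1,2}_{\mathrm{loc}}(0,\infty;\mathbb{R}^V)$ with $x(0)=x_0$ for which the inclusion holds for a.e. $t$, i.e. there are $\eta(t)\in\partial\varphi(x(t))$ and $\xi(t)\in\partial I_{K_a(t)}(x(t))$ with $x'(t)+\eta(t)+\xi(t)=h(t)$ for a.e. $t>0$. (It exists and is unique for the data considered.) For $p>2$ and $x_0=0$ the right-hand side of the decay estimate is read as $0$. *)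

theory Defs
  imports "HOL-Analysis.Analysis"
begin

text \<open>
  The vertex set is the sum type \<open>'n + 'm\<close> of two finite (hence nonempty) types: \<open>Inl\<close> enumerates
  \<open>v\<^sub>1, \<dots>, v\<^sub>n\<close> and \<open>Inr\<close> enumerates the constrained vertices \<open>v\<^sub>n\<^sub>+\<^sub>1, \<dots>, v\<^sub>n\<^sub>+\<^sub>m\<close>, so that
  \<open>\<real>\<^sup>V\<close> is \<^typ>\<open>real ^ ('n + 'm)\<close>.  Functions of time are total functions on \<^typ>\<open>real\<close>; their values
  at negative times are irrelevant in every definition below.
\<close>

text \<open>The values of the weight outside of \<open>E\<close> are irrelevant.\<close>

definition hypergraph :: "'v::finite set set \<Rightarrow> ('v set \<Rightarrow> real) \<Rightarrow> bool" where
  "hypergraph E w \<longleftrightarrow> (\<forall>e\<in>E. 2 \<le> card e \<and> 0 < w e)"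

definition hypergraph_connected :: "'v set set \<Rightarrow> bool" where
  "hypergraph_connected E \<longleftrightarrow>
     (\<forall>u v. \<exists>N\<ge>1. \<exists>(us :: nat \<Rightarrow> 'v) es. us 0 = u \<and> us N = v \<and>
        (\<forall>j\<in>{1..N}. es j \<in> E \<and> us (j - 1) \<in> es j \<and> us j \<in> es j))"

definition edge_variation :: "'v::finite set \<Rightarrow> real ^ 'v \<Rightarrow> real" where
  "edge_variation e x = Max {x $ u - x $ v |u v. u \<in> e \<and> v \<in> e}"

definition energy :: "'v::finite set set \<Rightarrow> ('v set \<Rightarrow> real) \<Rightarrow> real \<Rightarrow> real ^ 'v \<Rightarrow> real" where
  "energy E w p x = (1 / p) * (\<Sum>e\<in>E. w e * edge_variation e x powr p)"

definition subdifferential :: "('a::real_inner \<Rightarrow> ereal) \<Rightarrow> 'a \<Rightarrow> 'a set" where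
  "subdifferential \<psi> x =
     (if \<psi> x < \<infinity> then {\<eta>. \<forall>z. ereal (\<eta> \<bullet> (z - x)) \<le> \<psi> z - \<psi> x} else {})"

definition indicator_function :: "'a set \<Rightarrow> 'a \<Rightarrow> ereal" where
  "indicator_function K x = (if x \<in> K then 0 else \<infinity>)"

definition constraint_set ::
    "(real \<Rightarrow> real ^ ('n::finite + 'm::finite)) \<Rightarrow> real \<Rightarrow> (real ^ ('n + 'm)) set" where
  "constraint_set a t = {x. \<forall>j. x $ Inr j = a t $ Inr j}"

definition Lspace :: "real \<Rightarrow> real set \<Rightarrow> (real \<Rightarrow> 'a::euclidean_space) set" where
  "Lspace q S = {f. f \<in> borel_measurable (lebesgue_on S) \<and>
                    integrable (lebesgue_on S) (\<lambda>t. norm (f t) powr q)}"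

text \<open>Integrability is required up to the end point \<open>0\<close>.\<close>

definition Lspace_loc :: "real \<Rightarrow> (real \<Rightarrow> 'a::euclidean_space) set" where
  "Lspace_loc q = {f. \<forall>T>0. f \<in> Lspace q {0<..<T}}"

text \<open>Test functions for the weak derivative on \<open>(0, \<infinity>)\<close> are the continuously differentiable
  functions with compact support in \<open>(0, \<infinity>)\<close>, extended by zero to \<^typ>\<open>real\<close>.  As usual,
  both functions are required to be integrable on compact subintervals of \<open>(0, \<infinity>)\<close>.\<close>

definition test_function :: "(real \<Rightarrow> real) \<Rightarrow> (real \<Rightarrow> real) \<Rightarrow> bool" where
  "test_function \<theta> \<theta>' \<longleftrightarrow>
     (\<forall>t. (\<theta> has_real_derivative \<theta>' t) (at t)) \<and> continuous_on UNIV \<theta>' \<and>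
     (\<exists>b c. 0 < b \<and> b \<le> c \<and> (\<forall>t. t \<notin> {b..c} \<longrightarrow> \<theta> t = 0))"

definition has_weak_derivative ::
    "(real \<Rightarrow> 'a::euclidean_space) \<Rightarrow> (real \<Rightarrow> 'a) \<Rightarrow> bool" where
  "has_weak_derivative f f' \<longleftrightarrow>
     (\<forall>b c. 0 < b \<longrightarrow> b \<le> c \<longrightarrow>
        integrable (lebesgue_on {b..c}) f \<and> integrable (lebesgue_on {b..c}) f') \<and>
     (\<forall>\<theta> \<theta>'. test_function \<theta> \<theta>' \<longrightarrow>
        (LINT t|lebesgue_on {0<..}. \<theta>' t *\<^sub>R f t) = - (LINT t|lebesgue_on {0<..}. \<theta> t *\<^sub>R f' t))"

text \<open>Elements of \<open>W\<^sup>1\<^sup>,\<^sup>2\<close> are identified with their continuous representatives on \<open>[0, \<infinity>)\<close>,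
  which gives a meaning to point values such as \<open>f 0\<close>.\<close>

definition W12_loc :: "(real \<Rightarrow> 'a::euclidean_space) set" where
  "W12_loc = {f. continuous_on {0..} f \<and> f \<in> Lspace_loc 2 \<and>
                 (\<exists>f'. has_weak_derivative f f' \<and> f' \<in> Lspace_loc 2)}"

definition global_solution ::
    "('n::finite + 'm::finite) set set \<Rightarrow> (('n + 'm) set \<Rightarrow> real) \<Rightarrow> real \<Rightarrow>
     (real \<Rightarrow> real ^ ('n + 'm)) \<Rightarrow> (real \<Rightarrow> real ^ ('n + 'm)) \<Rightarrow>
     real ^ ('n + 'm) \<Rightarrow> (real \<Rightarrow> real ^ ('n + 'm)) \<Rightarrow> bool" where
  "global_solution E w p a h x\<^sub>0 x \<longleftrightarrow>
     x \<in> W12_loc \<and> x 0 = x\<^sub>0 \<and>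
     (\<exists>x'. has_weak_derivative x x' \<and>
        (AE t in lebesgue_on {0<..}.
           \<exists>\<eta> \<in> subdifferential (\<lambda>y. ereal (energy E w p y)) (x t).
           \<exists>\<xi> \<in> subdifferential (indicator_function (constraint_set a t)) (x t).
             x' t + \<eta> + \<xi> = h t))"

end

theory Submission imports Defs begin

text \<open>
  Let \<open>z\<close> be the part of the solution \<open>x\<close> on the free vertices, extended by zero, so that \<open>x = z + a\<close>.  Taking the inner
  product of the inclusion with \<open>z\<close> removes the constraint force, which is orthogonal to \<open>z\<close>, and also
  the derivative of \<open>a\<close>, which lives on the other vertices.  With the subgradient inequality for the energy
  \<open>\<phi>\<close> this gives, in integrated form, \<open>(\<parallel>z\<parallel>\<^sup>2 / 2)' + \<phi>(x) \<le> \<phi>(a) + z \<bullet> h\<close>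
  (lemma \<open>global_solution_energy_inequality\<close>).  Since the hypergraph is connected and has constrained vertices, a
  Poincare inequality \<open>c \<parallel>z\<parallel>\<^sup>p \<le> \<phi>(z)\<close> holds (\<open>energy_ge_norm_powr\<close>), by summing along paths.

  For the convergence, \<open>\<phi>(a) \<le> C \<parallel>a\<parallel>\<^sup>p\<close> and \<open>h\<close> are integrable, so the inequality first bounds \<open>z\<close>, then shows that
  \<open>\<phi>(x)\<close> and therefore \<open>\<parallel>z\<parallel>\<^sup>p\<close> are integrable, and finally that the increments of \<open>\<parallel>z\<parallel>\<^sup>2\<close> are bounded by those of a bounded
  nondecreasing function.  These last two facts force \<open>z \<rightarrow> 0\<close>
  (\<open>tendsto_zero_if_integrable_and_increments_bounded\<close>), and the same criterion gives \<open>a \<rightarrow> 0\<close>.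

  For \<open>a = h = 0\<close> one has \<open>z = x\<close>, and \<open>y = \<parallel>x\<parallel>\<close> satisfies \<open>y y' \<le> - c y\<^sup>p\<close>.  Integrating \<open>y\<^sup>1\<^sup>-\<^sup>p y' \<le> - c\<close> yields the three
  decay rates (\<open>power_law_decay\<close>).  No optimal rate is needed, so this step is carried out with difference
  quotients and a smaller constant.

  The only fact needed about weak derivatives is the fundamental theorem of calculus
  (\<open>weak_derivative_fundamental_theorem\<close>), together with one half of the chain rule for the squared norm
  (\<open>half_squared_norm_increment_le\<close>).
\<close>

section \<open>A continuously differentiable step function\<close>

text \<open>The step rises from 0 to 1 on \<open>[0, 2]\<close>.  Its derivative is the tent with peak 1 at \<open>1\<close>,
  and both are written with positive parts, so that differentiability at the joints follows from that of
  the squared positive part.\<close>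

definition step_fun :: "real \<Rightarrow> real" where
  "step_fun u = ((max 0 u)\<^sup>2 - 2 * (max 0 (u - 1))\<^sup>2 + (max 0 (u - 2))\<^sup>2) / 2"

text \<open>The tent function on \<open>[0, 2]\<close>, which is the derivative of \<^const>\<open>step_fun\<close>.\<close>

definition step_deriv :: "real \<Rightarrow> real" where
  "step_deriv u = max 0 u - 2 * max 0 (u - 1) + max 0 (u - 2)"

lemma has_real_derivative_pos_part_squared:
  "((\<lambda>u::real. (max 0 u)\<^sup>2) has_real_derivative 2 * max 0 u) (at u)"
proof (cases u "0::real" rule: linorder_cases)
  case less
  have "((\<lambda>u::real. 0) has_real_derivative 2 * max 0 u) (at u)"
    using less by simp
  then show ?thesis
    by (rule has_field_derivative_transform_within_open[where S="{..<0}"]) (use less in auto)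
next
  case greater
  have "((\<lambda>u::real. u\<^sup>2) has_real_derivative 2 * max 0 u) (at u)"
    using greater by (auto intro!: derivative_eq_intros)
  then show ?thesis
    by (rule has_field_derivative_transform_within_open[where S="{0<..}"]) (use greater in auto)
next
  case equal
  have "((\<lambda>h::real. (max 0 h)\<^sup>2 / h) \<longlongrightarrow> 0) (at 0)"
  proof (rule Lim_null_comparison[where g="\<lambda>h. \<bar>h\<bar>"])
    show "\<forall>\<^sub>F h in at (0::real). norm ((max 0 h)\<^sup>2 / h) \<le> \<bar>h\<bar>"
      by (rule always_eventually) (auto simp: max_def power2_eq_square)
    show "((\<lambda>h::real. \<bar>h\<bar>) \<longlongrightarrow> 0) (at 0)"
      by (intro tendsto_eq_intros) auto
  qed
  then show ?thesis using equal by (simp add: DERIV_def)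
qed

lemma step_fun_has_derivative: "(step_fun has_real_derivative step_deriv u) (at u)"
proof -
  have *: "((\<lambda>u::real. (max 0 (u - c))\<^sup>2) has_real_derivative 2 * max 0 (u - c)) (at u)" for c
  proof -
    have "((\<lambda>u. u - c) has_real_derivative 1) (at u)"
      by (auto intro!: derivative_eq_intros)
    from DERIV_chain2[where f="\<lambda>v::real. (max 0 v)\<^sup>2", OF has_real_derivative_pos_part_squared this]
    show ?thesis by simp
  qed
  show ?thesis
    unfolding step_fun_def[abs_def] step_deriv_def
    by (rule derivative_eq_intros * *[of 0, simplified] refl | simp)+
qed

lemma step_fun_eq_0: "u \<le> 0 \<Longrightarrow> step_fun u = 0"
  by (simp add: step_fun_def)

lemma step_fun_eq_1: "2 \<le> u \<Longrightarrow> step_fun u = 1"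
  by (simp add: step_fun_def power2_eq_square algebra_simps)

lemma step_fun_bounds: "0 \<le> step_fun u \<and> step_fun u \<le> 1"
proof -
  consider "u \<le> 0" | "0 \<le> u" "u \<le> 1" | "1 \<le> u" "u \<le> 2" | "2 \<le> u" by linarith
  then show ?thesis
  proof cases
    case 2
    then have "step_fun u = u\<^sup>2 / 2" by (simp add: step_fun_def)
    moreover have "u\<^sup>2 \<le> 1" using 2 by (simp add: power_le_one)
    ultimately show ?thesis using zero_le_power2[of u] by linarith
  next
    case 3
    then have "step_fun u = 1 - (2 - u)\<^sup>2 / 2"
      by (simp add: step_fun_def power2_eq_square field_simps)
    moreover have "(2 - u)\<^sup>2 \<le> 1" using 3 by (simp add: power_le_one)
    ultimately show ?thesis using zero_le_power2[of "2 - u"] by linarith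
  qed (simp_all add: step_fun_eq_0 step_fun_eq_1)
qed

lemma step_deriv_eq_0: "u \<le> 0 \<or> 2 \<le> u \<Longrightarrow> step_deriv u = 0"
  by (auto simp: step_deriv_def max_def)

lemma step_deriv_nonneg: "0 \<le> step_deriv u"
  by (auto simp: step_deriv_def max_def)

lemma continuous_on_step_deriv [continuous_intros]:
  "continuous_on S f \<Longrightarrow> continuous_on S (\<lambda>t. step_deriv (f t))"
  unfolding step_deriv_def by (intro continuous_intros)

lemma scaled_step_fun_has_derivative:
  "((\<lambda>r. step_fun (k * (r - s))) has_real_derivative k * step_deriv (k * (r - s))) (at r within S)"
proof -
  have "((\<lambda>r. k * (r - s)) has_real_derivative k) (at r within S)"
    by (auto intro!: derivative_eq_intros)
  from DERIV_chain2[where f=step_fun, OF step_fun_has_derivative this]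
  show ?thesis by (simp add: mult.commute)
qed

text \<open>For \<open>k \<ge> 2\<close> both scaled steps have finished within time 1 after their start.\<close>

lemma step_difference_eq_0:
  assumes "s \<le> t" "2 \<le> k" "r \<notin> {s..t+1}"
  shows "step_fun (k * (r - s)) - step_fun (k * (r - t)) = 0 \<and>
    k * step_deriv (k * (r - s)) - k * step_deriv (k * (r - t)) = 0"
proof (cases "r < s")
  case True
  then have "k * (r - s) \<le> 0" "k * (r - t) \<le> 0"
    using assms by (auto simp: mult_le_0_iff)
  then show ?thesis by (simp add: step_fun_eq_0 step_deriv_eq_0)
next
  case False
  then have "1 \<le> r - s" "1 \<le> r - t" using assms by auto
  then have "2 * 1 \<le> k * (r - s)" "2 * 1 \<le> k * (r - t)"
    using assms by (intro mult_mono; simp)+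
  then show ?thesis by (simp add: step_fun_eq_1 step_deriv_eq_0)
qed

lemma test_function_step_difference:
  assumes "0 < s" "s \<le> t" "2 \<le> k"
  shows "test_function (\<lambda>r. step_fun (k * (r - s)) - step_fun (k * (r - t)))
           (\<lambda>r. k * step_deriv (k * (r - s)) - k * step_deriv (k * (r - t)))"
  unfolding test_function_def
proof (intro conjI allI)
  show "((\<lambda>r. step_fun (k * (r - s)) - step_fun (k * (r - t))) has_real_derivative
          k * step_deriv (k * (r - s)) - k * step_deriv (k * (r - t))) (at r)" for r
    by (intro DERIV_diff scaled_step_fun_has_derivative)
  show "continuous_on UNIV (\<lambda>r. k * step_deriv (k * (r - s)) - k * step_deriv (k * (r - t)))"
    by (intro continuous_intros)
  show "\<exists>b c. 0 < b \<and> b \<le> c \<and>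
      (\<forall>r. r \<notin> {b..c} \<longrightarrow> step_fun (k * (r - s)) - step_fun (k * (r - t)) = 0)"
    using assms step_difference_eq_0[OF assms(2,3)] by (intro exI[of _ s] exI[of _ "t+1"]) auto
qed

section \<open>The fundamental theorem of calculus for weak derivatives\<close>

text \<open>The rescaled derivatives of the step function are an approximate identity.\<close>

lemma step_deriv_approximates_point_value:
  fixes f :: "real \<Rightarrow> 'a::euclidean_space"
  assumes cont: "continuous_on {s..c} f" and "s < c"
  shows "(\<lambda>k. integral {s..c} (\<lambda>r. (real k * step_deriv (real k * (r - s))) *\<^sub>R f r)) \<longlonglongrightarrow> f s"
proof (rule metric_LIMSEQ_I)
  fix e :: real assume "0 < e"
  then obtain d where d: "d > 0" "\<And>r. r \<in> {s..c} \<Longrightarrow> dist r s < d \<Longrightarrow> dist (f r) (f s) < e / 2"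
    using cont \<open>s < c\<close> unfolding continuous_on_iff
    by (metis atLeastAtMost_iff half_gt_zero less_eq_real_def order_refl)
  obtain N :: nat where N: "2 / min d (c - s) < real N" using reals_Archimedean2 by blast
  show "\<exists>N. \<forall>k\<ge>N. dist (integral {s..c} (\<lambda>r. (real k * step_deriv (real k * (r - s))) *\<^sub>R f r)) (f s) < e"
  proof (intro exI allI impI)
    fix k assume "N \<le> k"
    have m: "0 < min d (c - s)" using d \<open>s < c\<close> by simp
    have "2 < real N * min d (c - s)" using N m by (simp add: pos_divide_less_eq)
    also have "\<dots> \<le> real k * min d (c - s)" using \<open>N \<le> k\<close> m by (intro mult_right_mono) auto
    finally have k: "2 < real k * min d (c - s)" .
    have k0: "0 < real k" using k m by (metis less_numeral_extra(3) mult_zero_left not_gr_zero of_nat_0 of_nat_0_less_iff order_less_asym' zero_less_numeral)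
    have kd: "2 < real k * d" "2 < real k * (c - s)"
      using k k0 mult_left_mono[of "min d (c - s)" d "real k"]
        mult_left_mono[of "min d (c - s)" "c - s" "real k"] by linarith+
    define \<rho> where "\<rho> r = real k * step_deriv (real k * (r - s))" for r
    have rho0: "0 \<le> \<rho> r" for r unfolding \<rho>_def by (simp add: step_deriv_nonneg)
    have "(\<rho> has_integral (step_fun (real k * (c - s)) - step_fun (real k * (s - s)))) {s..c}"
      unfolding \<rho>_def using \<open>s < c\<close> scaled_step_fun_has_derivative
      by (intro fundamental_theorem_of_calculus)
         (auto simp: has_real_derivative_iff_has_vector_derivative)
    then have rho1: "(\<rho> has_integral 1) {s..c}"
      using kd by (simp add: step_fun_eq_0 step_fun_eq_1)
    have crho: "continuous_on {s..c} \<rho>" unfolding \<rho>_def by (intro continuous_intros)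
    have "((\<lambda>r. \<rho> r *\<^sub>R f s) has_integral f s) {s..c}"
      using has_integral_scaleR_left[OF rho1, of "f s"] by simp
    then have "integral {s..c} (\<lambda>r. \<rho> r *\<^sub>R f r) - f s
        = integral {s..c} (\<lambda>r. \<rho> r *\<^sub>R f r) - integral {s..c} (\<lambda>r. \<rho> r *\<^sub>R f s)"
      by (simp add: integral_unique)
    also have "\<dots> = integral {s..c} (\<lambda>r. \<rho> r *\<^sub>R f r - \<rho> r *\<^sub>R f s)"
      by (rule integral_diff[symmetric])
         (auto intro!: integrable_continuous_real continuous_intros crho cont)
    finally have "norm (integral {s..c} (\<lambda>r. \<rho> r *\<^sub>R f r) - f s)
        = norm (integral {s..c} (\<lambda>r. \<rho> r *\<^sub>R f r - \<rho> r *\<^sub>R f s))" by simp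
    also have "\<dots> \<le> integral {s..c} (\<lambda>r. \<rho> r * (e / 2))"
    proof (rule integral_norm_bound_integral)
      show "(\<lambda>r. \<rho> r *\<^sub>R f r - \<rho> r *\<^sub>R f s) integrable_on {s..c}"
        by (auto intro!: integrable_continuous_real continuous_intros crho cont)
      show "(\<lambda>r. \<rho> r * (e / 2)) integrable_on {s..c}"
        by (auto intro!: integrable_continuous_real continuous_intros crho)
      show "norm (\<rho> r *\<^sub>R f r - \<rho> r *\<^sub>R f s) \<le> \<rho> r * (e / 2)" if r: "r \<in> {s..c}" for r
      proof (cases "r - s < d")
        case True
        then have "norm (f r - f s) \<le> e / 2"
          using d(2)[OF r] r by (simp add: dist_norm)
        then show ?thesis
          using rho0[of r] mult_left_mono[of "norm (f r - f s)" "e / 2" "\<rho> r"]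
          by (simp add: scaleR_diff_right[symmetric])
      next
        case False
        then have "real k * d \<le> real k * (r - s)" using k0 by (intro mult_left_mono) auto
        then have "\<rho> r = 0" unfolding \<rho>_def using kd by (simp add: step_deriv_eq_0)
        then show ?thesis by simp
      qed
    qed
    also have "\<dots> = e / 2" using integral_unique[OF has_integral_mult_left[OF rho1, of "e/2"]] by simp
    also have "\<dots> < e" using \<open>0 < e\<close> by simp
    finally show "dist (integral {s..c} (\<lambda>r. (real k * step_deriv (real k * (r - s))) *\<^sub>R f r)) (f s) < e"
      unfolding dist_norm \<rho>_def .
  qed
qed

lemma integral_lebesgue_on_subset:
  fixes g :: "real \<Rightarrow> 'a::euclidean_space"
  assumes "integrable (lebesgue_on S) g" "S \<in> sets lebesgue" "A \<in> sets lebesgue" "S \<subseteq> A"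
    and "\<And>r. r \<notin> S \<Longrightarrow> g r = 0"
  shows "integral\<^sup>L (lebesgue_on A) g = integral S g"
proof -
  have "(\<lambda>r. indicator A r *\<^sub>R g r) = (\<lambda>r. indicator S r *\<^sub>R g r)"
    using assms(4,5) by (fastforce simp: indicator_def)
  then have "integral\<^sup>L (lebesgue_on A) g = integral\<^sup>L (lebesgue_on S) g"
    using assms(2,3) by (simp add: integral_restrict_space)
  also have "\<dots> = integral S g" by (rule lebesgue_integral_eq_integral) fact+
  finally show ?thesis .
qed

lemma has_weak_derivative_imp_absolutely_integrable:
  fixes f f' :: "real \<Rightarrow> 'a::euclidean_space"
  assumes "has_weak_derivative f f'" "0 < s"
  shows "f' absolutely_integrable_on {s..t}"
proof (cases "s \<le> t")
  case True
  then have "integrable (lebesgue_on {s..t}) f'"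
    using assms unfolding has_weak_derivative_def by blast
  then show ?thesis
    by (simp add: integrable_restrict_space set_integrable_def)
qed auto

text \<open>The weak derivative is tested against differences of steep steps at \<open>s\<close> and \<open>t\<close>.  These converge
  boundedly to the indicator of the interval from \<open>s\<close> to \<open>t\<close>, while their derivatives tend to the
  difference of the point masses at \<open>s\<close> and \<open>t\<close>.\<close>

lemma weak_derivative_fundamental_theorem:
  fixes f f' :: "real \<Rightarrow> 'a::euclidean_space"
  assumes wd: "has_weak_derivative f f'" and cont: "continuous_on {0..} f" and st: "0 < s" "s \<le> t"
  shows "integral {s..t} f' = f t - f s"
proof -
  define c where "c = t + 1"
  define \<theta> where "\<theta> k r = step_fun (real k * (r - s)) - step_fun (real k * (r - t))" for k r
  define \<theta>' where "\<theta>' k r = real k * step_deriv (real k * (r - s)) - real k * step_deriv (real k * (r - t))" for k r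
  have tc: "s < c" "t < c" "s \<le> c" using st by (auto simp: c_def)
  have contc: "continuous_on {b..d} f" if "0 < b" for b d
    by (rule continuous_on_subset[OF cont]) (use that in auto)
  have absf': "f' absolutely_integrable_on {s..c}"
    by (rule has_weak_derivative_imp_absolutely_integrable[OF wd st(1)])
  have th_bound: "\<bar>\<theta> k r\<bar> \<le> 1" for k r
    unfolding \<theta>_def using step_fun_bounds[of "real k * (r - s)"] step_fun_bounds[of "real k * (r - t)"] by linarith
  have contth: "continuous_on A (\<theta> k)" for k A
  proof -
    have "isCont (\<theta> k) r" for r
      unfolding \<theta>_def[abs_def]
      using DERIV_isCont[OF DERIV_diff[OF scaled_step_fun_has_derivative scaled_step_fun_has_derivative]]
      by blast
    then show ?thesis by (simp add: continuous_at_imp_continuous_on)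
  qed
  have absth: "(\<lambda>r. \<theta> k r *\<^sub>R f' r) absolutely_integrable_on {s..c}" for k
    by (rule absolutely_integrable_bounded_measurable_product[OF bilinear_conv_bounded_bilinear[THEN iffD2, OF bounded_bilinear_scaleR] _ _ _ absf'])
       (auto intro!: continuous_imp_measurable_on_sets_lebesgue contth boundedI[of _ 1] simp: th_bound)
  have intth': "continuous_on {s..c} (\<lambda>r. \<theta>' k r *\<^sub>R f r)" for k
    unfolding \<theta>'_def using st by (intro continuous_intros contc)
  have zero: "\<theta> k r = 0 \<and> \<theta>' k r = 0" if "2 \<le> k" "r \<notin> {s..c}" for k r
    using step_difference_eq_0[OF st(2), of "real k" r] that by (simp add: \<theta>_def \<theta>'_def c_def)
  have eq: "integral {s..c} (\<lambda>r. \<theta>' k r *\<^sub>R f r) = - integral {s..c} (\<lambda>r. \<theta> k r *\<^sub>R f' r)" if k: "2 \<le> k" for k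
  proof -
    have "test_function (\<theta> k) (\<theta>' k)"
      unfolding \<theta>_def[abs_def] \<theta>'_def[abs_def] using test_function_step_difference st k by auto
    then have "(LINT r|lebesgue_on {0<..}. \<theta>' k r *\<^sub>R f r) = - (LINT r|lebesgue_on {0<..}. \<theta> k r *\<^sub>R f' r)"
      using wd unfolding has_weak_derivative_def by blast
    moreover have "(LINT r|lebesgue_on {0<..}. \<theta>' k r *\<^sub>R f r) = integral {s..c} (\<lambda>r. \<theta>' k r *\<^sub>R f r)"
      using zero[OF k] st
      by (intro integral_lebesgue_on_subset)
         (auto intro!: absolutely_integrable_imp_integrable absolutely_integrable_continuous_real intth')
    moreover have "(LINT r|lebesgue_on {0<..}. \<theta> k r *\<^sub>R f' r) = integral {s..c} (\<lambda>r. \<theta> k r *\<^sub>R f' r)"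
      using zero[OF k] st
      by (intro integral_lebesgue_on_subset)
         (auto intro!: absolutely_integrable_imp_integrable absth)
    ultimately show ?thesis by simp
  qed
  have lim1: "(\<lambda>k. integral {s..c} (\<lambda>r. \<theta>' k r *\<^sub>R f r)) \<longlonglongrightarrow> f s - f t"
  proof -
    have i: "(\<lambda>r. (real k * step_deriv (real k * (r - d))) *\<^sub>R f r) integrable_on {b..c}" if "0 < b" for k d b
      using that by (intro integrable_continuous_real continuous_intros contc)
    have "integral {s..c} (\<lambda>r. \<theta>' k r *\<^sub>R f r) =
       integral {s..c} (\<lambda>r. (real k * step_deriv (real k * (r - s))) *\<^sub>R f r) -
       integral {t..c} (\<lambda>r. (real k * step_deriv (real k * (r - t))) *\<^sub>R f r)" for k
    proof -
      have "integral {s..c} (\<lambda>r. (real k * step_deriv (real k * (r - t))) *\<^sub>R f r)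
          = integral {s..t} (\<lambda>r. (real k * step_deriv (real k * (r - t))) *\<^sub>R f r)
            + integral {t..c} (\<lambda>r. (real k * step_deriv (real k * (r - t))) *\<^sub>R f r)"
        using st tc i by (intro Henstock_Kurzweil_Integration.integral_combine[symmetric]) auto
      also have "integral {s..t} (\<lambda>r. (real k * step_deriv (real k * (r - t))) *\<^sub>R f r) 
          = integral {s..t} (\<lambda>r. 0)"
        by (rule Henstock_Kurzweil_Integration.integral_cong) (simp add: step_deriv_eq_0 mult_nonneg_nonpos)
      finally show ?thesis
        using i[OF st(1)] by (simp add: \<theta>'_def scaleR_diff_left integral_diff)
    qed
    moreover have "(\<lambda>k. integral {s..c} (\<lambda>r. (real k * step_deriv (real k * (r - s))) *\<^sub>R f r) -
       integral {t..c} (\<lambda>r. (real k * step_deriv (real k * (r - t))) *\<^sub>R f r)) \<longlonglongrightarrow> f s - f t"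
      using st tc by (intro tendsto_diff step_deriv_approximates_point_value contc) auto
    ultimately show ?thesis by simp
  qed
  have lim2: "(\<lambda>k. integral {s..c} (\<lambda>r. \<theta> k r *\<^sub>R f' r)) \<longlonglongrightarrow> integral {s..c} (\<lambda>r. if r \<in> {s<..t} then f' r else 0)"
  proof (rule dominated_convergence(2)[where h="\<lambda>r. norm (f' r)"])
    show "(\<lambda>r. \<theta> k r *\<^sub>R f' r) integrable_on {s..c}" for k
      using absth absolutely_integrable_on_def by blast
    show "(\<lambda>r. norm (f' r)) integrable_on {s..c}"
      using absf' absolutely_integrable_on_def by blast
    show "norm (\<theta> k r *\<^sub>R f' r) \<le> norm (f' r)" for k r
      using th_bound[of k r] by (simp add: mult_left_le_one_le)
    have ev: "\<forall>\<^sub>F k in sequentially. step_fun (real k * u) = 1" if "0 < u" for u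
    proof -
      obtain N :: nat where N: "2 / u < real N" using reals_Archimedean2 by blast
      have "step_fun (real k * u) = 1" if "N \<le> k" for k
      proof -
        have "2 < real N * u" using N \<open>0 < u\<close> by (simp add: pos_divide_less_eq)
        also have "\<dots> \<le> real k * u" using \<open>N \<le> k\<close> \<open>0 < u\<close> by (intro mult_right_mono) auto
        finally show ?thesis by (simp add: step_fun_eq_1)
      qed
      then show ?thesis by (auto simp: eventually_sequentially)
    qed
    have z: "step_fun (real k * u) = 0" if "u \<le> 0" for u k
      using that by (intro step_fun_eq_0) (simp add: mult_le_0_iff)
    show "(\<lambda>k. \<theta> k r *\<^sub>R f' r) \<longlonglongrightarrow> (if r \<in> {s<..t} then f' r else 0)" if r: "r \<in> {s..c}" for r
    proof -
      consider "r = s" | "s < r" "r \<le> t" | "t < r" using r by fastforce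
      then show ?thesis
      proof cases
        case 1
        then have "\<theta> k r = 0" for k using z[of "r - s"] z[of "r - t"] st by (simp add: \<theta>_def)
        then show ?thesis using 1 by simp
      next
        case 2
        then have "\<forall>\<^sub>F k in sequentially. \<theta> k r *\<^sub>R f' r = f' r"
          using ev[of "r - s"] z[of "r - t"] by (auto simp: \<theta>_def elim!: eventually_mono)
        then show ?thesis using 2 by (simp add: tendsto_eventually)
      next
        case 3
        then have "\<forall>\<^sub>F k in sequentially. \<theta> k r *\<^sub>R f' r = 0"
          using eventually_conj[OF ev[of "r - s"] ev[of "r - t"]] st
          by (auto simp: \<theta>_def elim!: eventually_mono)
        then show ?thesis using 3 by (simp add: tendsto_eventually)
      qed
    qed
  qed
  \<comment> \<open>The half-open interval arises because every step is \<open>0\<close> at its starting point.\<close>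
  have "integral {s..c} (\<lambda>r. if r \<in> {s<..t} then f' r else 0) = integral {s<..t} f'"
  proof -
    have "{s<..t} \<inter> {s..c} = {s<..t}" using tc by auto
    then show ?thesis
      using integral_restrict_Int[of "{s..c}" "{s<..t}" f'] by simp
  qed
  also have "\<dots> = integral {s..t} f'"
    by (rule integral_spike_set; rule negligible_subset[of "{s}"]) auto
  finally have lim2': "(\<lambda>k. - integral {s..c} (\<lambda>r. \<theta> k r *\<^sub>R f' r)) \<longlonglongrightarrow> - integral {s..t} f'"
    using tendsto_minus[OF lim2] by simp
  have "(\<lambda>k. - integral {s..c} (\<lambda>r. \<theta> k r *\<^sub>R f' r)) \<longlonglongrightarrow> f s - f t"
    using lim1 by (rule Lim_transform_eventually) (use eq in \<open>auto simp: eventually_sequentially\<close>)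
  from LIMSEQ_unique[OF this lim2'] show ?thesis by (simp add: algebra_simps)
qed

section \<open>Half of the chain rule for the squared norm\<close>

text \<open>An inequality between nearby times, with a uniform notion of nearby, propagates along \<open>[s, t]\<close>.  This
  replaces differentiation almost everywhere in the arguments below.\<close>

lemma locally_decreasing_imp_decreasing:
  fixes D :: "real \<Rightarrow> real"
  assumes "0 < d" "s \<le> t"
    and loc: "\<And>a b. s \<le> a \<Longrightarrow> a \<le> b \<Longrightarrow> b \<le> t \<Longrightarrow> b - a < d \<Longrightarrow> D b \<le> D a"
  shows "D t \<le> D s"
proof -
  have "D b \<le> D s" if "s \<le> b" "b \<le> t" "b - s < real n * (d / 2)" for n b
    using that
  proof (induction n arbitrary: b)
    case (Suc n)
    show ?case
    proof (cases "b - d / 2 < s")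
      case True
      then show ?thesis using Suc.prems \<open>0 < d\<close> by (intro loc) auto
    next
      case False
      then have "D (b - d / 2) \<le> D s"
        using Suc.prems \<open>0 < d\<close> by (intro Suc.IH) (auto simp: field_simps)
      moreover have "D b \<le> D (b - d / 2)"
        using False Suc.prems \<open>0 < d\<close> by (intro loc) auto
      ultimately show ?thesis by linarith
    qed
  qed auto
  moreover obtain n :: nat where "(t - s) / (d / 2) < real n" using reals_Archimedean2 by blast
  ultimately show ?thesis using assms(1,2) by (simp add: pos_divide_less_eq)
qed

lemma absolutely_integrable_inner_continuous:
  fixes f g :: "real \<Rightarrow> 'a::euclidean_space"
  assumes "continuous_on {s..t} f" "g absolutely_integrable_on {s..t}"
  shows "(\<lambda>r. f r \<bullet> g r) absolutely_integrable_on {s..t}"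
  using assms
  by (intro absolutely_integrable_bounded_measurable_product
        [OF bilinear_conv_bounded_bilinear[THEN iffD2, OF bounded_bilinear_inner]]
        continuous_imp_measurable_on_sets_lebesgue compact_imp_bounded compact_continuous_image) auto

text \<open>The inequality suffices for the energy estimate, and avoids a product rule.  Convexity of the
  squared norm gives the bound with \<open>f b\<close> in place of \<open>f r\<close> on a short interval \<open>{a..b}\<close>; uniform continuity controls the difference.\<close>

lemma half_squared_norm_increment_le:
  fixes f g :: "real \<Rightarrow> 'a::euclidean_space"
  assumes "s \<le> t" and cont: "continuous_on {s..t} f" and g: "g absolutely_integrable_on {s..t}"
    and ftc: "\<And>a b. s \<le> a \<Longrightarrow> a \<le> b \<Longrightarrow> b \<le> t \<Longrightarrow> integral {a..b} g = f b - f a"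
  shows "(norm (f t))\<^sup>2 / 2 - (norm (f s))\<^sup>2 / 2 \<le> integral {s..t} (\<lambda>r. f r \<bullet> g r)"
proof -
  define G where "G = integral {s..t} (\<lambda>r. norm (g r))"
  have ng: "(\<lambda>r. norm (g r)) integrable_on {s..t}"
    using g absolutely_integrable_on_def by blast
  have G0: "0 \<le> G" unfolding G_def using ng by (intro Henstock_Kurzweil_Integration.integral_nonneg) auto
  have fg: "(\<lambda>r. f r \<bullet> g r) integrable_on {s..t}"
    using absolutely_integrable_inner_continuous[OF cont g] set_lebesgue_integral_eq_integral(1) by blast
  have *: "(norm (f t))\<^sup>2 / 2 - (norm (f s))\<^sup>2 / 2 \<le> integral {s..t} (\<lambda>r. f r \<bullet> g r) + e * G" if "0 < e" for e
  proof -
    define H where "H r = f r \<bullet> g r + e * norm (g r)" for r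
    have H: "H integrable_on {s..t}"
      unfolding H_def using integrable_add[OF fg integrable_cmul[OF ng, of e]] by simp
    have "uniformly_continuous_on {s..t} f"
      using cont by (intro compact_uniformly_continuous) auto
    then obtain d where d: "0 < d" "\<And>a b. a \<in> {s..t} \<Longrightarrow> b \<in> {s..t} \<Longrightarrow> dist b a < d \<Longrightarrow> dist (f b) (f a) < e"
      unfolding uniformly_continuous_on_def using \<open>0 < e\<close> by metis
    define D where "D b = (norm (f b))\<^sup>2 / 2 - integral {s..b} H" for b
    have "D t \<le> D s"
    proof (rule locally_decreasing_imp_decreasing[OF d(1) \<open>s \<le> t\<close>])
      fix a b assume ab: "s \<le> a" "a \<le> b" "b \<le> t" "b - a < d"
      have sub: "{a..b} \<subseteq> {s..t}" "{s..b} \<subseteq> {s..t}" using ab by auto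
      have Hab: "H integrable_on {a..b}" "H integrable_on {s..b}"
        using integrable_on_subinterval[OF H sub(1)] integrable_on_subinterval[OF H sub(2)] by auto
      have gab: "g integrable_on {a..b}"
        using g integrable_on_subinterval sub(1) absolutely_integrable_on_def by blast
      have "0 \<le> (norm (f b - f a))\<^sup>2" by simp
      then have "(norm (f b))\<^sup>2 / 2 - (norm (f a))\<^sup>2 / 2 \<le> f b \<bullet> (f b - f a)"
        by (simp add: power2_norm_eq_inner inner_diff inner_commute)
      also have "\<dots> = f b \<bullet> integral {a..b} g" using ftc ab by simp
      also have "\<dots> = integral {a..b} (\<lambda>r. f b \<bullet> g r)"
        using integral_linear[OF gab bounded_linear_inner_right[of "f b"]] by (simp add: o_def)
      also have "\<dots> \<le> integral {a..b} H"
      proof (rule integral_le[OF _ Hab(1)])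
        show "(\<lambda>r. f b \<bullet> g r) integrable_on {a..b}"
          using integrable_linear[OF gab bounded_linear_inner_right[of "f b"]] by (simp add: o_def)
        fix r assume r: "r \<in> {a..b}"
        have "f b \<bullet> g r - f r \<bullet> g r = (f b - f r) \<bullet> g r" by (simp add: inner_diff_left)
        also have "\<dots> \<le> norm (f b - f r) * norm (g r)" by (rule norm_cauchy_schwarz)
        also have "\<dots> \<le> e * norm (g r)"
        proof (rule mult_right_mono)
          have "dist b r < d" using r ab by (auto simp: dist_real_def)
          then have "dist (f b) (f r) < e" using r ab by (intro d(2)) auto
          then show "norm (f b - f r) \<le> e" by (simp add: dist_norm)
        qed simp
        finally show "f b \<bullet> g r \<le> H r" by (simp add: H_def)
      qed
      also have "\<dots> = integral {s..b} H - integral {s..a} H"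
        using Henstock_Kurzweil_Integration.integral_combine[OF ab(1,2) Hab(2)] by simp
      finally show "D b \<le> D a" by (simp add: D_def)
    qed
    then have "(norm (f t))\<^sup>2 / 2 - (norm (f s))\<^sup>2 / 2 \<le> integral {s..t} H"
      by (simp add: D_def)
    also have "\<dots> = integral {s..t} (\<lambda>r. f r \<bullet> g r) + e * G"
      unfolding H_def G_def
      using Henstock_Kurzweil_Integration.integral_add[OF fg integrable_cmul[OF ng, of e]] by simp
    finally show ?thesis .
  qed
  show ?thesis
  proof (rule field_le_epsilon)
    fix e :: real assume "0 < e"
    then have "e / (G + 1) * G \<le> e" "0 < e / (G + 1)" using G0 by (auto simp: field_simps)
    then show "(norm (f t))\<^sup>2 / 2 - (norm (f s))\<^sup>2 / 2 \<le> integral {s..t} (\<lambda>r. f r \<bullet> g r) + e"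
      using *[of "e / (G + 1)"] by linarith
  qed
qed

section \<open>Decay criteria for real functions\<close>

text \<open>A nonnegative function whose \<open>q\<close>-th power has bounded integrals and with increments bounded by those of a
  bounded nondecreasing function tends to zero: it is small at some arbitrarily late times, and cannot
  grow much afterwards.\<close>

lemma tendsto_zero_if_integrable_and_increments_bounded:
  fixes y G :: "real \<Rightarrow> real"
  assumes q: "0 < q" and y0: "\<And>t. 1 \<le> t \<Longrightarrow> 0 \<le> y t"
    and cont: "continuous_on {1..} y"
    and int: "\<And>t. 1 \<le> t \<Longrightarrow> integral {1..t} (\<lambda>r. y r powr q) \<le> B"
    and incr: "\<And>s t. 1 \<le> s \<Longrightarrow> s \<le> t \<Longrightarrow> y t \<le> y s + (G t - G s)"
    and mono: "\<And>s t. 1 \<le> s \<Longrightarrow> s \<le> t \<Longrightarrow> G s \<le> G t"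
    and bdd: "\<And>t. 1 \<le> t \<Longrightarrow> G t \<le> C"
  shows "(y \<longlongrightarrow> 0) at_top"
proof (rule tendstoI)
  fix e :: real assume e: "0 < e"
  define L where "L = (SUP t\<in>{1..}. G t)"
  have bdd': "bdd_above (G ` {1..})" using bdd by (auto intro!: bdd_aboveI[of _ C])
  have upper: "G t \<le> L" if "1 \<le> t" for t
    unfolding L_def using that bdd' by (intro cSUP_upper) auto
  obtain T where T: "1 \<le> T" "L - e / 2 < G T"
    using less_cSUP_iff[OF _ bdd', of "L - e / 2"] e by (auto simp: L_def)
  have ypow: "continuous_on {a..b} (\<lambda>r. y r powr q)" if "1 \<le> a" for a b
    using that q y0 by (intro continuous_on_powr' continuous_on_subset[OF cont]) auto
  \<comment> \<open>Otherwise the \<open>q\<close>-th power would stay above a positive constant on all of \<open>[T, \<infinity>)\<close>.\<close>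
  have "\<exists>s\<ge>T. y s < e / 2"
  proof (rule ccontr)
    assume "\<not> ?thesis"
    then have ge: "e / 2 \<le> y s" if "T \<le> s" for s using that by force
    define c where "c = (e / 2) powr q"
    have c: "0 < c" using e by (simp add: c_def)
    define S where "S = T + (\<bar>B\<bar> + 1) / c"
    have "0 \<le> (\<bar>B\<bar> + 1) / c" using c by simp
    then have S: "T \<le> S" "1 \<le> S" using T by (auto simp: S_def)
    have "\<bar>B\<bar> + 1 = integral {T..S} (\<lambda>r. c)" using c S by (simp add: S_def)
    also have "\<dots> \<le> integral {T..S} (\<lambda>r. y r powr q)"
      using T q e ge unfolding c_def
      by (intro integral_le integrable_continuous_real ypow powr_mono2) (auto intro: continuous_intros)
    also have "\<dots> \<le> integral {1..S} (\<lambda>r. y r powr q)"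
      using T by (intro integral_subset_le integrable_continuous_real ypow) auto
    also have "\<dots> \<le> B" by (rule int) fact
    finally show False by linarith
  qed
  then obtain s where s: "T \<le> s" "y s < e / 2" by blast
  have "dist (y t) 0 < e" if "s \<le> t" for t
  proof -
    have "y t \<le> y s + (G t - G s)" using s T that by (intro incr) auto
    moreover have "G T \<le> G s" using s T by (intro mono) auto
    moreover have "G t \<le> L" using s T that by (intro upper) auto
    moreover have "0 \<le> y t" using s T that by (intro y0) auto
    ultimately show ?thesis using s T by (simp add: dist_real_def)
  qed
  then show "\<forall>\<^sub>F t in at_top. dist (y t) 0 < e"
    by (auto simp: eventually_at_top_linorder)
qed

text \<open>The hypothesis on \<open>y\<close> is an integrated form of \<open>y y' \<le> - c y\<^sup>p\<close>, so that an antiderivative \<open>\<Psi>\<close> of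
  \<open>v \<mapsto> v\<^sup>1\<^sup>-\<^sup>p\<close> should decrease along \<open>y\<close> at a linear rate.  Since \<open>y\<close> is positive on \<open>[0, T]\<close>, its values at
  nearby times differ by a factor of at most 2; the mean value theorem then gives the claim, at the
  price of the factors \<open>2\<^sup>1\<^sup>-\<^sup>p\<close> and \<open>2/3\<close> in the rate.\<close>

lemma quadratic_decay_imp_linear_decay:
  fixes y \<Psi> :: "real \<Rightarrow> real"
  assumes "0 < c" and p: "1 \<le> p" and T: "0 \<le> T"
    and cont: "continuous_on {0..T} y"
    and pos: "\<And>t. 0 \<le> t \<Longrightarrow> t \<le> T \<Longrightarrow> 0 < y t"
    and decay: "\<And>s t. 0 \<le> s \<Longrightarrow> s \<le> t \<Longrightarrow> t \<le> T \<Longrightarrow> (y t)\<^sup>2 + 2 * c * (t - s) * y t powr p \<le> (y s)\<^sup>2"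
    and \<Psi>: "\<And>v. 0 < v \<Longrightarrow> (\<Psi> has_real_derivative v powr (1 - p)) (at v)"
  shows "\<Psi> (y T) + 2 powr (1 - p) * (2 * c / 3) * T \<le> \<Psi> (y 0)"
proof -
  define \<kappa> where "\<kappa> = 2 powr (1 - p) * (2 * c / 3)"
  obtain m where m: "m \<in> {0..T}" "\<And>t. t \<in> {0..T} \<Longrightarrow> y m \<le> y t"
    using continuous_attains_inf[OF _ _ cont] T by auto
  have "uniformly_continuous_on {0..T} y"
    using cont by (intro compact_uniformly_continuous) auto
  then obtain d where d: "0 < d" "\<And>a b. a \<in> {0..T} \<Longrightarrow> b \<in> {0..T} \<Longrightarrow> dist b a < d \<Longrightarrow> dist (y b) (y a) < y m"
    unfolding uniformly_continuous_on_def using pos[of m] m(1) by (metis atLeastAtMost_iff)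
  have "\<Psi> (y T) + \<kappa> * T \<le> \<Psi> (y 0) + \<kappa> * 0"
  proof (rule locally_decreasing_imp_decreasing[OF d(1) T])
    fix s t assume st: "0 \<le> s" "s \<le> t" "t \<le> T" "t - s < d"
    have yt: "0 < y t" "0 < y s" using pos st by auto
    have "dist (y t) (y s) < y m" using st by (intro d(2)) (auto simp: dist_real_def)
    then have y2: "y s \<le> 2 * y t" using m(2)[of t] st by (simp add: dist_real_def)
    have "0 \<le> 2 * c * (t - s) * y t powr p" using \<open>0 < c\<close> st by simp
    with decay[OF st(1-3)] have "(y t)\<^sup>2 \<le> (y s)\<^sup>2" by linarith
    then have yle: "y t \<le> y s" using yt by (simp add: power2_le_iff_abs_le)
    show "\<Psi> (y t) + \<kappa> * t \<le> \<Psi> (y s) + \<kappa> * s"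
    proof (cases "y t = y s")
      case True
      then have "2 * c * (t - s) * y t powr p \<le> 0" using decay[OF st(1-3)] by simp
      then have "t = s" using \<open>0 < c\<close> yt st by (auto simp: mult_le_0_iff)
      then show ?thesis by simp
    next
      case False
      with yle have lt: "y t < y s" by simp
      obtain \<xi> where \<xi>: "y t < \<xi>" "\<xi> < y s" "\<Psi> (y s) - \<Psi> (y t) = (y s - y t) * \<xi> powr (1 - p)"
        using MVT2[OF lt, of \<Psi> "\<lambda>v. v powr (1 - p)"] \<Psi> yt by (metis less_le_trans)
      have "2 * c * (t - s) * y t powr p \<le> (y s - y t) * (y s + y t)"
        using decay[OF st(1-3)] by (simp add: algebra_simps power2_eq_square)
      also have "\<dots> \<le> (y s - y t) * (3 * y t)"
        using y2 yle by (intro mult_left_mono) auto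
      finally have "2 * c / 3 * (t - s) * y t powr p \<le> (y s - y t) * y t" by simp
      moreover have "y t powr p = y t powr (p - 1) * y t"
        using yt by (simp add: powr_diff)
      ultimately have "(2 * c / 3 * (t - s) * y t powr (p - 1)) * y t \<le> (y s - y t) * y t"
        by (simp add: mult.assoc)
      then have 1: "2 * c / 3 * (t - s) * y t powr (p - 1) \<le> y s - y t"
        using yt mult_le_cancel_right_pos by blast
      have "(2 * y t) powr (1 - p) \<le> \<xi> powr (1 - p)"
        using \<xi> y2 yt p by (intro powr_mono2') auto
      then have 2: "2 powr (1 - p) * y t powr (1 - p) \<le> \<xi> powr (1 - p)"
        using yt by (simp add: powr_mult)
      have "\<kappa> * (t - s) = (2 * c / 3 * (t - s) * y t powr (p - 1)) * (2 powr (1 - p) * y t powr (1 - p))"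
      proof -
        have "y t powr (p - 1) * y t powr (1 - p) = 1" using yt by (simp flip: powr_add)
        then have "\<kappa> * (t - s) = \<kappa> * (t - s) * (y t powr (p - 1) * y t powr (1 - p))" by simp
        then show ?thesis unfolding \<kappa>_def by (simp add: mult_ac)
      qed
      also have "\<dots> \<le> (y s - y t) * \<xi> powr (1 - p)"
        using 1 2 lt by (intro mult_mono) auto
      finally show ?thesis using \<xi>(3) by (simp add: algebra_simps)
    qed
  qed
  then show ?thesis by (simp add: \<kappa>_def)
qed

text \<open>Here \<open>\<Psi> v\<close> is \<open>v\<^sup>2\<^sup>-\<^sup>p / (2 - p)\<close> or, for \<open>p = 2\<close>, the logarithm.\<close>

lemma power_law_decay:
  fixes y :: "real \<Rightarrow> real"
  assumes c: "0 < c" and p: "1 \<le> p" and T: "0 \<le> T"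
    and cont: "continuous_on {0..} y" and nonneg: "\<And>t. 0 \<le> y t"
    and decay: "\<And>s t. 0 \<le> s \<Longrightarrow> s \<le> t \<Longrightarrow> (y t)\<^sup>2 + 2 * c * (t - s) * y t powr p \<le> (y s)\<^sup>2"
    and \<gamma>: "\<gamma> = (if p = 2 then 1 else \<bar>2 - p\<bar>) * (2 powr (1 - p) * (2 * c / 3))"
  shows "y T \<le> (if p < 2 then (max 0 (y 0 powr (2 - p) - \<gamma> * T)) powr (1 / (2 - p))
            else if p = 2 then y 0 * exp (- \<gamma> * T)
            else if y 0 = 0 then 0
            else (y 0 powr (- (p - 2)) + \<gamma> * T) powr (- (1 / (p - 2))))"
proof (cases "y T = 0")
  case True
  then show ?thesis using nonneg[of 0] by simp
next
  case False
  define \<kappa> where "\<kappa> = 2 powr (1 - p) * (2 * c / 3)"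
  have \<kappa>: "0 < \<kappa>" using c by (simp add: \<kappa>_def)
  have yT: "0 < y T" using False nonneg[of T] by linarith
  have mono: "y t \<le> y s" if "0 \<le> s" "s \<le> t" for s t
  proof -
    have "0 \<le> 2 * c * (t - s) * y t powr p" using c that by simp
    with decay[OF that] have "(y t)\<^sup>2 \<le> (y s)\<^sup>2" by linarith
    then show ?thesis using nonneg by (rule power2_le_imp_le)
  qed
  have pos: "0 < y t" if "0 \<le> t" "t \<le> T" for t
    using mono[OF that] yT by linarith
  have y0: "0 < y 0" using pos T by simp
  have key: "\<Psi> (y T) + \<kappa> * T \<le> \<Psi> (y 0)"
    if "\<And>v. 0 < v \<Longrightarrow> (\<Psi> has_real_derivative v powr (1 - p)) (at v)" for \<Psi>
    unfolding \<kappa>_def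
    by (rule quadratic_decay_imp_linear_decay[OF c p T _ pos decay that])
       (auto intro: continuous_on_subset[OF cont])
  have powder: "((\<lambda>v. v powr (2 - p) / (2 - p)) has_real_derivative v powr (1 - p)) (at v)"
    if "0 < v" "p \<noteq> 2" for v
    using DERIV_cdivide[OF has_real_derivative_powr[OF that(1), of "2 - p"], of "2 - p"] that(2) by simp
  consider "p < 2" | "p = 2" | "2 < p" by linarith
  then show ?thesis
  proof cases
    case 1
    have g: "\<gamma> = (2 - p) * \<kappa>" using 1 by (simp add: \<gamma> \<kappa>_def)
    have "y T powr (2 - p) / (2 - p) + \<kappa> * T \<le> y 0 powr (2 - p) / (2 - p)"
      using 1 by (intro key powder) auto
    then have "y T powr (2 - p) + \<gamma> * T \<le> y 0 powr (2 - p)"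
      using 1 mult_left_mono[of "y T powr (2 - p) / (2 - p) + \<kappa> * T" "y 0 powr (2 - p) / (2 - p)" "2 - p"]
      by (simp add: g distrib_left)
    then have "(y T powr (2 - p)) powr (1 / (2 - p))
        \<le> (max 0 (y 0 powr (2 - p) - \<gamma> * T)) powr (1 / (2 - p))"
      using 1 by (intro powr_mono2) auto
    then show ?thesis using 1 yT by (simp add: powr_powr)
  next
    case 2
    have g: "\<gamma> = \<kappa>" using 2 by (simp only: \<gamma> \<kappa>_def) simp
    have "ln (y T) + \<kappa> * T \<le> ln (y 0)"
      using 2 by (intro key) (auto intro!: derivative_eq_intros simp: powr_minus field_simps)
    then have "exp (ln (y T)) \<le> exp (ln (y 0) - \<kappa> * T)" by simp
    then show ?thesis using 2 yT y0
      by (simp add: g exp_diff exp_minus field_simps)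
  next
    case 3
    have g: "\<gamma> = (p - 2) * \<kappa>" using 3 by (simp add: \<gamma> \<kappa>_def)
    have "y T powr (2 - p) / (2 - p) + \<kappa> * T \<le> y 0 powr (2 - p) / (2 - p)"
      using 3 by (intro key powder) auto
    then have "y 0 powr (2 - p) \<le> y T powr (2 - p) + (2 - p) * (\<kappa> * T)"
      using 3 mult_left_mono_neg[of "y T powr (2 - p) / (2 - p) + \<kappa> * T" "y 0 powr (2 - p) / (2 - p)" "2 - p"]
      by (simp add: distrib_left)
    then have *: "y 0 powr (2 - p) + \<gamma> * T \<le> y T powr (2 - p)"
      by (simp add: g algebra_simps)
    have "0 \<le> \<gamma> * T" using 3 T \<kappa> by (simp add: g)
    then have "0 < y 0 powr (2 - p) + \<gamma> * T" using y0 by (intro add_pos_nonneg) auto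
    then have "(y T powr (2 - p)) powr (- (1 / (p - 2)))
        \<le> (y 0 powr (2 - p) + \<gamma> * T) powr (- (1 / (p - 2)))"
      using 3 * by (intro powr_mono2') auto
    moreover have "(2 - p) * (- (1 / (p - 2))) = 1" using 3 by (simp add: field_simps)
    ultimately show ?thesis using 3 yT y0 by (simp add: powr_powr)
  qed
qed

section \<open>The hypergraph energy\<close>

lemma hypergraph_edge_nonempty: "hypergraph E w \<Longrightarrow> e \<in> E \<Longrightarrow> e \<noteq> {}"
  unfolding hypergraph_def by (metis card.empty not_numeral_le_zero)

lemma finite_edge_differences:
  fixes e :: "'v::finite set"
  shows "finite {x $ u - x $ v |u v. u \<in> e \<and> v \<in> e}"
proof -
  have "{x $ u - x $ v |u v. u \<in> e \<and> v \<in> e} = (\<lambda>(u, v). x $ u - x $ v) ` (e \<times> e)" by auto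
  then show ?thesis by simp
qed

lemma diff_le_edge_variation: "u \<in> e \<Longrightarrow> v \<in> e \<Longrightarrow> x $ u - x $ v \<le> edge_variation e x"
  unfolding edge_variation_def by (rule Max_ge[OF finite_edge_differences]) auto

lemma edge_variation_le:
  assumes "e \<noteq> {}" "\<And>u v. u \<in> e \<Longrightarrow> v \<in> e \<Longrightarrow> x $ u - x $ v \<le> B"
  shows "edge_variation e x \<le> B"
proof -
  have "{x $ u - x $ v |u v. u \<in> e \<and> v \<in> e} \<noteq> {}" using assms(1) by blast
  then show ?thesis
    unfolding edge_variation_def
    by (rule Max.boundedI[OF finite_edge_differences]) (use assms(2) in auto)
qed

lemma edge_variation_nonneg: "e \<noteq> {} \<Longrightarrow> 0 \<le> edge_variation e x"
  using diff_le_edge_variation[of _ e _ x] by force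

lemma edge_variation_add_le:
  "e \<noteq> {} \<Longrightarrow> edge_variation e (x + y) \<le> edge_variation e x + edge_variation e y"
proof (rule edge_variation_le)
  fix u v assume "u \<in> e" "v \<in> e"
  then show "(x + y) $ u - (x + y) $ v \<le> edge_variation e x + edge_variation e y"
    using diff_le_edge_variation[of u e v x] diff_le_edge_variation[of u e v y] by simp
qed

lemma edge_variation_le_norm: "e \<noteq> {} \<Longrightarrow> edge_variation e x \<le> 2 * norm x"
proof (rule edge_variation_le)
  fix u v
  show "x $ u - x $ v \<le> 2 * norm x"
    using component_le_norm_cart[of x u] component_le_norm_cart[of x v] by linarith
qed

lemma continuous_on_edge_variation:
  assumes "e \<noteq> {}" shows "continuous_on S (edge_variation e)"
proof -
  have le: "edge_variation e x - edge_variation e y \<le> 2 * norm (x - y)" for x y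
    using edge_variation_add_le[OF assms, of "x - y" y] edge_variation_le_norm[OF assms, of "x - y"] by simp
  have "2-lipschitz_on S (edge_variation e)"
  proof (rule lipschitz_onI)
    show "dist (edge_variation e x) (edge_variation e y) \<le> 2 * dist x y" for x y
      using le[of x y] le[of y x] by (simp add: dist_norm dist_real_def norm_minus_commute)
  qed simp
  then show ?thesis by (rule lipschitz_on_continuous_on)
qed

lemma energy_nonneg:
  assumes "hypergraph E w" "1 \<le> p" shows "0 \<le> energy E w p x"
  using assms unfolding energy_def hypergraph_def
  by (intro mult_nonneg_nonneg sum_nonneg) (auto intro: less_imp_le)

lemma energy_zero: "hypergraph E w \<Longrightarrow> energy E w p 0 = 0"
proof -
  assume "hypergraph E w"
  then have "edge_variation e 0 = 0" if "e \<in> E" for e :: "'a set"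
    using edge_variation_nonneg[of e 0] edge_variation_le_norm[of e 0]
      hypergraph_edge_nonempty[OF _ that] by fastforce
  then show ?thesis by (simp add: energy_def)
qed

lemma continuous_on_energy:
  assumes "hypergraph E w" "1 \<le> p" and f: "continuous_on S f"
  shows "continuous_on S (\<lambda>t. energy E w p (f t))"
proof -
  have "continuous_on S (\<lambda>t. edge_variation e (f t) powr p)" if "e \<in> E" for e
    using assms(2) hypergraph_edge_nonempty[OF assms(1) that]
    by (intro continuous_on_powr' continuous_on_compose2[OF continuous_on_edge_variation f])
       (auto intro: edge_variation_nonneg)
  then show ?thesis unfolding energy_def by (intro continuous_on_mult_left continuous_on_sum) auto
qed

lemma energy_le_norm_powr:
  assumes G: "hypergraph E w" and p: "1 \<le> p"
  obtains C where "0 \<le> C" "\<And>x. energy E w p x \<le> C * norm x powr p"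
proof
  let ?C = "(1 / p) * (\<Sum>e\<in>E. w e * 2 powr p)"
  show "0 \<le> ?C" using G p unfolding hypergraph_def
    by (intro mult_nonneg_nonneg sum_nonneg) (auto intro: less_imp_le)
  fix x
  have "(\<Sum>e\<in>E. w e * edge_variation e x powr p) \<le> (\<Sum>e\<in>E. w e * (2 powr p * norm x powr p))"
  proof (rule sum_mono)
    fix e assume e: "e \<in> E"
    note ne = hypergraph_edge_nonempty[OF G e]
    have "edge_variation e x powr p \<le> (2 * norm x) powr p"
      using p edge_variation_nonneg[OF ne] edge_variation_le_norm[OF ne] by (intro powr_mono2) auto
    then show "w e * edge_variation e x powr p \<le> w e * (2 powr p * norm x powr p)"
      using G e unfolding hypergraph_def by (intro mult_left_mono) (auto simp: powr_mult intro: less_imp_le)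
  qed
  then have "energy E w p x \<le> (1 / p) * (\<Sum>e\<in>E. w e * (2 powr p * norm x powr p))"
    unfolding energy_def using p by (intro mult_left_mono) auto
  then show "energy E w p x \<le> ?C * norm x powr p"
    by (simp add: sum_distrib_right mult.assoc)
qed

lemma energy_diff_le:
  assumes G: "hypergraph E w" and p: "1 \<le> p"
  shows "energy E w p (x - y) \<le> 2 powr p * (energy E w p x + energy E w p y)"
proof -
  have ub: "edge_variation e (x - y) powr p \<le> 2 powr p * (edge_variation e x powr p + edge_variation e y powr p)"
    if e: "e \<in> E" for e
  proof -
    note ne = hypergraph_edge_nonempty[OF G e]
    let ?a = "edge_variation e x" and ?b = "edge_variation e y"
    have nn: "0 \<le> ?a" "0 \<le> ?b" using edge_variation_nonneg[OF ne] by auto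
    have "edge_variation e (x - y) \<le> 2 * max ?a ?b"
    proof (rule edge_variation_le[OF ne])
      fix u v assume "u \<in> e" "v \<in> e"
      then have "x $ u - x $ v \<le> ?a" "y $ v - y $ u \<le> ?b" by (auto intro: diff_le_edge_variation)
      then show "(x - y) $ u - (x - y) $ v \<le> 2 * max ?a ?b" by simp
    qed
    then have "edge_variation e (x - y) powr p \<le> (2 * max ?a ?b) powr p"
      using p edge_variation_nonneg[OF ne] by (intro powr_mono2) auto
    also have "\<dots> = 2 powr p * max ?a ?b powr p" by (rule powr_mult)
    also have "\<dots> \<le> 2 powr p * (?a powr p + ?b powr p)"
      by (intro mult_left_mono) (auto simp: max_def)
    finally show ?thesis .
  qed
  have "(\<Sum>e\<in>E. w e * edge_variation e (x - y) powr p)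
      \<le> (\<Sum>e\<in>E. w e * (2 powr p * (edge_variation e x powr p + edge_variation e y powr p)))"
    using G ub unfolding hypergraph_def by (intro sum_mono mult_left_mono) (auto intro: less_imp_le)
  also have "\<dots> = 2 powr p * ((\<Sum>e\<in>E. w e * edge_variation e x powr p) + (\<Sum>e\<in>E. w e * edge_variation e y powr p))"
    by (simp add: sum.distrib[symmetric] sum_distrib_left algebra_simps)
  finally have "(1 / p) * (\<Sum>e\<in>E. w e * edge_variation e (x - y) powr p) \<le> (1 / p) * \<dots>"
    using p by (intro mult_left_mono) auto
  then show ?thesis unfolding energy_def by (simp add: algebra_simps add_divide_distrib)
qed

text \<open>Along a path joining two vertices, the difference of the values is at most the number of steps times
  the sum of all edge variations.\<close>

lemma path_difference_le:
  fixes x :: "real ^ 'v::finite"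
  assumes G: "hypergraph E w"
    and path: "\<forall>j\<in>{1..N}. es j \<in> E \<and> us (j - 1) \<in> es j \<and> us j \<in> es j"
  shows "\<bar>x $ us N - x $ us 0\<bar> \<le> real N * (\<Sum>e\<in>E. edge_variation e x)"
  using path
proof (induction N)
  case (Suc N)
  have IH: "\<bar>x $ us N - x $ us 0\<bar> \<le> real N * (\<Sum>e\<in>E. edge_variation e x)"
    using Suc.prems by (intro Suc.IH) auto
  have e: "es (Suc N) \<in> E" "us N \<in> es (Suc N)" "us (Suc N) \<in> es (Suc N)"
    using Suc.prems[rule_format, of "Suc N"] by auto
  have "\<bar>x $ us (Suc N) - x $ us N\<bar> \<le> edge_variation (es (Suc N)) x"
    using diff_le_edge_variation[OF e(2,3), of x] diff_le_edge_variation[OF e(3,2), of x] by linarith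
  also have "\<dots> \<le> (\<Sum>e\<in>E. edge_variation e x)"
    using e(1) edge_variation_nonneg hypergraph_edge_nonempty[OF G]
    by (intro member_le_sum) auto
  finally show ?case using IH by (simp add: distrib_right)
qed simp

text \<open>A Poincare inequality: on a connected hypergraph the energy controls the norm of every function that
  vanishes at the constrained vertices.\<close>

lemma energy_ge_norm_powr:
  fixes E :: "('n::finite + 'm::finite) set set"
  assumes G: "hypergraph E w" and conn: "hypergraph_connected E" and p: "1 \<le> p"
  obtains c where "0 < c" "\<And>z. (\<And>j. z $ Inr j = 0) \<Longrightarrow> c * norm z powr p \<le> energy E w p z"
proof -
  \<comment> \<open>Any constrained vertex serves as reference; the type \<open>'m\<close> is nonempty.\<close>
  fix j\<^sub>0 :: 'm
  have "\<exists>N. \<forall>x::real^('n+'m). \<bar>x $ u - x $ Inr j\<^sub>0\<bar> \<le> real N * (\<Sum>e\<in>E. edge_variation e x)" for u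
  proof -
    obtain N and us :: "nat \<Rightarrow> 'n + 'm" and es where us: "us 0 = Inr j\<^sub>0" "us N = u"
      and path: "\<forall>j\<in>{1..N}. es j \<in> E \<and> us (j - 1) \<in> es j \<and> us j \<in> es j"
      using conn[unfolded hypergraph_connected_def, rule_format, of "Inr j\<^sub>0" u] by blast
    show ?thesis using path_difference_le[OF G path] unfolding us by blast
  qed
  then have "\<forall>u. \<exists>N. \<forall>x::real^('n+'m). \<bar>x $ u - x $ Inr j\<^sub>0\<bar> \<le> real N * (\<Sum>e\<in>E. edge_variation e x)"
    by blast
  from choice[OF this] obtain N :: "'n + 'm \<Rightarrow> nat"
    where N: "\<And>u x. \<bar>x $ u - x $ Inr j\<^sub>0\<bar> \<le> real (N u) * (\<Sum>e\<in>E. edge_variation e x)"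
    by blast
  define M where "M = (\<Sum>u\<in>UNIV. real (N u))"
  \<comment> \<open>The summand 1 only keeps \<open>D\<close> positive.\<close>
  define D where "D = M * (\<Sum>e\<in>E. (p / w e) powr (1 / p)) + 1"
  have D: "0 < D" unfolding D_def M_def by (intro add_nonneg_pos mult_nonneg_nonneg sum_nonneg) auto
  have main: "D powr (- p) * norm z powr p \<le> energy E w p z" if z: "\<And>j. z $ Inr j = 0" for z
  proof -
    let ?\<phi> = "energy E w p z"
    have phi: "0 \<le> ?\<phi>" by (rule energy_nonneg[OF G p])
    have var: "edge_variation e z \<le> (p / w e) powr (1 / p) * ?\<phi> powr (1 / p)" if e: "e \<in> E" for e
    proof -
      have w: "0 < w e" "\<And>e. e \<in> E \<Longrightarrow> 0 < w e" using G e unfolding hypergraph_def by auto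
      note nn = edge_variation_nonneg[OF hypergraph_edge_nonempty[OF G e], of z]
      have "w e * edge_variation e z powr p \<le> (\<Sum>e\<in>E. w e * edge_variation e z powr p)"
        using e w(2) by (intro member_le_sum) (auto intro!: mult_nonneg_nonneg intro: less_imp_le)
      also have "\<dots> = p * ?\<phi>" using p by (simp add: energy_def)
      finally have "edge_variation e z powr p \<le> p / w e * ?\<phi>"
        using w by (simp add: field_simps)
      then have "(edge_variation e z powr p) powr (1 / p) \<le> (p / w e * ?\<phi>) powr (1 / p)"
        using p by (intro powr_mono2) auto
      moreover have "(edge_variation e z powr p) powr (1 / p) = edge_variation e z"
        using nn p by (simp add: powr_powr)
      moreover have "(p / w e * ?\<phi>) powr (1 / p) = (p / w e) powr (1 / p) * ?\<phi> powr (1 / p)"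
        by (rule powr_mult)
      ultimately show ?thesis by simp
    qed
    have "norm z \<le> (\<Sum>u\<in>UNIV. \<bar>z $ u\<bar>)" by (rule norm_le_l1_cart)
    also have "\<dots> \<le> (\<Sum>u\<in>UNIV. real (N u) * (\<Sum>e\<in>E. edge_variation e z))"
      using N[of z] z by (intro sum_mono) simp
    also have "\<dots> = M * (\<Sum>e\<in>E. edge_variation e z)" by (simp add: M_def sum_distrib_right)
    also have "\<dots> \<le> M * (\<Sum>e\<in>E. (p / w e) powr (1 / p) * ?\<phi> powr (1 / p))"
      unfolding M_def using var by (intro mult_left_mono sum_mono sum_nonneg) auto
    also have "\<dots> \<le> D * ?\<phi> powr (1 / p)"
      by (simp add: D_def sum_distrib_right distrib_right mult.assoc)
    finally have "norm z powr p \<le> (D * ?\<phi> powr (1 / p)) powr p"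
      using p by (intro powr_mono2) auto
    also have "\<dots> = D powr p * ?\<phi>"
      using D p phi by (simp add: powr_mult powr_powr)
    finally have "D powr (- p) * norm z powr p \<le> D powr (- p) * (D powr p * ?\<phi>)"
      by (intro mult_left_mono) auto
    also have "\<dots> = ?\<phi>" using D by (simp add: powr_minus)
    finally show ?thesis .
  qed
  show ?thesis by (rule that[of "D powr (- p)"]) (use D main in auto)
qed

section \<open>The energy inequality along a solution\<close>

text \<open>The orthogonal projection of \<open>\<real>\<^sup>V\<close> onto the functions that vanish at the constrained vertices.\<close>

definition free_part :: "real ^ ('n::finite + 'm::finite) \<Rightarrow> real ^ ('n + 'm)" where
  "free_part x = (\<chi> i. case i of Inl k \<Rightarrow> x $ Inl k | Inr j \<Rightarrow> 0)"

lemma free_part_nth [simp]: "free_part x $ Inl k = x $ Inl k" "free_part x $ Inr j = 0"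
  by (simp_all add: free_part_def)

lemma vec_eq_sum_iff: "x = y \<longleftrightarrow> (\<forall>k. x $ Inl k = y $ Inl k) \<and> (\<forall>j. x $ Inr j = y $ Inr j)"
  by (metis sumE vec_eq_iff)

lemma bounded_linear_free_part: "bounded_linear free_part"
  unfolding linear_conv_bounded_linear[symmetric]
  by (rule linearI) (simp_all add: vec_eq_sum_iff)

lemma inner_free_part: "free_part x \<bullet> free_part y = free_part x \<bullet> y"
proof -
  have "free_part x $ i * free_part y $ i = free_part x $ i * y $ i" for i
    by (cases i) auto
  then show ?thesis unfolding inner_vec_def by (intro sum.cong) simp_all
qed

lemma subdifferential_indicatorD:
  assumes "\<xi> \<in> subdifferential (indicator_function K) x"
  shows "x \<in> K" "\<And>z. z \<in> K \<Longrightarrow> \<xi> \<bullet> (z - x) \<le> 0"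
proof -
  show "x \<in> K" using assms by (auto simp: subdifferential_def indicator_function_def split: if_splits)
  then have all: "\<forall>z. ereal (\<xi> \<bullet> (z - x)) \<le> indicator_function K z"
    using assms by (auto simp: subdifferential_def indicator_function_def)
  show "\<xi> \<bullet> (z - x) \<le> 0" if "z \<in> K" for z
    using spec[OF all, of z] that by (simp add: indicator_function_def zero_ereal_def)
qed

lemma subdifferential_energyD:
  "\<eta> \<in> subdifferential (\<lambda>y. ereal (energy E w p y)) x \<Longrightarrow>
    \<eta> \<bullet> (z - x) \<le> energy E w p z - energy E w p x"
  by (simp add: subdifferential_def)

text \<open>The constraint set is invariant under adding free parts, so the constraint force \<open>\<xi>\<close> is orthogonal to
  the free part of the solution.\<close>

lemma inclusion_tested_with_free_part:
  assumes \<eta>: "\<eta> \<in> subdifferential (\<lambda>y. ereal (energy E w p y)) x"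
    and \<xi>: "\<xi> \<in> subdifferential (indicator_function (constraint_set a t)) x"
    and eq: "x' + \<eta> + \<xi> = h"
  shows "free_part x \<bullet> x' \<le> free_part x \<bullet> h + energy E w p (x - free_part x) - energy E w p x"
proof -
  note K = subdifferential_indicatorD[OF \<xi>]
  have "x + free_part x \<in> constraint_set a t" "x - free_part x \<in> constraint_set a t"
    using K(1) by (auto simp: constraint_set_def)
  from K(2)[OF this(1)] K(2)[OF this(2)] have 1: "free_part x \<bullet> \<xi> = 0"
    by (simp add: inner_commute)
  have 2: "- (free_part x \<bullet> \<eta>) \<le> energy E w p (x - free_part x) - energy E w p x"
    using subdifferential_energyD[OF \<eta>, of "x - free_part x"] by (simp add: inner_commute)
  have "free_part x \<bullet> x' = free_part x \<bullet> h - free_part x \<bullet> \<eta> - free_part x \<bullet> \<xi>"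
    by (simp add: eq[symmetric] inner_add_right)
  then show ?thesis using 1 2 by simp
qed

lemma continuous_AE_zero_imp_zero:
  fixes f :: "real \<Rightarrow> real"
  assumes cont: "continuous_on {0..} f" and AE: "AE t in lebesgue_on {0<..}. f t = 0" and "0 < t"
  shows "f t = 0"
proof -
  have c: "continuous_on {t..t+1} (\<lambda>r. \<bar>f r\<bar>)"
    using \<open>0 < t\<close> by (intro continuous_intros continuous_on_subset[OF cont]) auto
  have "AE r in lebesgue. r \<in> {0<..} \<longrightarrow> f r = 0"
    using AE by (simp add: AE_restrict_space_iff)
  then have "AE r in lebesgue_on {t..t+1}. \<bar>f r\<bar> = 0"
    using \<open>0 < t\<close> by (subst AE_restrict_space_iff) (auto elim!: eventually_mono)
  then have "integral\<^sup>L (lebesgue_on {t..t+1}) (\<lambda>r. \<bar>f r\<bar>) = 0" by (rule integral_eq_zero_AE)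
  then have "integral {t..t+1} (\<lambda>r. \<bar>f r\<bar>) = 0"
    by (subst (asm) lebesgue_integral_eq_integral)
       (auto intro!: absolutely_integrable_imp_integrable absolutely_integrable_continuous_real c)
  then show ?thesis using integral_eq_0_iff[OF c] by auto
qed

text \<open>The inclusion gives the constraint at almost every time; continuity extends it to all positive times.\<close>

lemma global_solution_constraint:
  assumes sol: "global_solution E w p a h x\<^sub>0 x" and a: "continuous_on {0..} a"
    and a0: "\<forall>t\<ge>0. \<forall>i. a t $ Inl i = 0" and "0 < t"
  shows "x t - free_part (x t) = a t"
proof -
  have x: "continuous_on {0..} x" using sol by (auto simp: global_solution_def W12_loc_def)
  obtain x' where AE: "AE t in lebesgue_on {0<..}.
           \<exists>\<eta> \<in> subdifferential (\<lambda>y. ereal (energy E w p y)) (x t).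
           \<exists>\<xi> \<in> subdifferential (indicator_function (constraint_set a t)) (x t). x' t + \<eta> + \<xi> = h t"
    using sol by (auto simp: global_solution_def)
  have "x t $ Inr j = a t $ Inr j" for j
  proof -
    have "AE t in lebesgue_on {0<..}. x t $ Inr j - a t $ Inr j = 0"
      using AE by eventually_elim (auto dest!: subdifferential_indicatorD(1) simp: constraint_set_def)
    moreover have "continuous_on {0..} (\<lambda>t. x t $ Inr j - a t $ Inr j)"
      using x a by (intro continuous_intros)
    ultimately have "x t $ Inr j - a t $ Inr j = 0"
      using \<open>0 < t\<close> continuous_AE_zero_imp_zero by blast
    then show ?thesis by simp
  qed
  then show ?thesis using a0 \<open>0 < t\<close> by (auto simp: vec_eq_sum_iff)
qed

text \<open>Only positive initial times are considered, because the weak derivative in the inclusion is known to be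
  integrable on compact subintervals of \<open>(0, \<infinity>)\<close> only.\<close>

lemma global_solution_energy_inequality:
  assumes G: "hypergraph E w" and p: "1 \<le> p"
    and sol: "global_solution E w p a h x\<^sub>0 x" and st: "0 < s" "s \<le> t"
    and h: "h absolutely_integrable_on {s..t}"
  shows "(norm (free_part (x t)))\<^sup>2 / 2 + integral {s..t} (\<lambda>r. energy E w p (x r))
    \<le> (norm (free_part (x s)))\<^sup>2 / 2
      + integral {s..t} (\<lambda>r. free_part (x r) \<bullet> h r + energy E w p (x r - free_part (x r)))"
proof -
  have x: "continuous_on {0..} x" using sol by (auto simp: global_solution_def W12_loc_def)
  obtain x' where wd: "has_weak_derivative x x'" and AE: "AE t in lebesgue_on {0<..}.
           \<exists>\<eta> \<in> subdifferential (\<lambda>y. ereal (energy E w p y)) (x t).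
           \<exists>\<xi> \<in> subdifferential (indicator_function (constraint_set a t)) (x t). x' t + \<eta> + \<xi> = h t"
    using sol by (auto simp: global_solution_def)
  interpret F: bounded_linear free_part by (rule bounded_linear_free_part)
  define z where "z r = free_part (x r)" for r
  define R where "R r = z r \<bullet> h r + energy E w p (x r - z r) - energy E w p (x r)" for r
  have xc: "continuous_on {s..t} x" using st by (intro continuous_on_subset[OF x]) auto
  have zc: "continuous_on {s..t} z" unfolding z_def by (rule F.continuous_on[OF xc])
  have ax': "x' absolutely_integrable_on {s..t}"
    by (rule has_weak_derivative_imp_absolutely_integrable[OF wd st(1)])
  have az': "(\<lambda>r. free_part (x' r)) absolutely_integrable_on {s..t}"
    using absolutely_integrable_linear[OF ax' bounded_linear_free_part] by (simp add: o_def)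
  have ftc: "integral {b..d} (\<lambda>r. free_part (x' r)) = z d - z b" if "s \<le> b" "b \<le> d" for b d
  proof -
    have "x' integrable_on {b..d}"
      using has_weak_derivative_imp_absolutely_integrable[OF wd, of b d] st that
        absolutely_integrable_on_def by fastforce
    from integral_linear[OF this bounded_linear_free_part]
    show ?thesis using weak_derivative_fundamental_theorem[OF wd x, of b d] st that
      by (simp add: o_def z_def F.diff)
  qed
  have en: "continuous_on {s..t} (\<lambda>r. energy E w p (x r))"
    "continuous_on {s..t} (\<lambda>r. energy E w p (x r - z r))"
    by (intro continuous_on_energy[OF G p] continuous_intros xc zc)+
  have izh: "(\<lambda>r. z r \<bullet> h r) absolutely_integrable_on {s..t}"
    by (rule absolutely_integrable_inner_continuous[OF zc h])
  have aR: "R absolutely_integrable_on {s..t}"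
    unfolding R_def using izh en absolutely_integrable_continuous_real
    by (intro set_integral_diff set_integral_add) auto
  have azz': "(\<lambda>r. z r \<bullet> free_part (x' r)) absolutely_integrable_on {s..t}"
    by (rule absolutely_integrable_inner_continuous[OF zc az'])
  have "(norm (z t))\<^sup>2 / 2 - (norm (z s))\<^sup>2 / 2 \<le> integral {s..t} (\<lambda>r. z r \<bullet> free_part (x' r))"
    by (rule half_squared_norm_increment_le[OF st(2) zc az']) (rule ftc)
  also have "\<dots> = (LINT r|lebesgue_on {s..t}. z r \<bullet> free_part (x' r))"
    by (rule lebesgue_integral_eq_integral[symmetric])
       (auto intro!: absolutely_integrable_imp_integrable azz')
  also have "\<dots> \<le> (LINT r|lebesgue_on {s..t}. R r)"
  proof (rule integral_mono_AE)
    have "AE r in lebesgue_on {0<..}. z r \<bullet> free_part (x' r) \<le> R r"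
      using AE
    proof eventually_elim
      case (elim r)
      then show ?case
        using inclusion_tested_with_free_part[of _ E w p "x r" _ a r "x' r" "h r"]
        by (auto simp: z_def R_def inner_free_part)
    qed
    then show "AE r in lebesgue_on {s..t}. z r \<bullet> free_part (x' r) \<le> R r"
      using st by (simp add: AE_restrict_space_iff) (auto elim!: eventually_mono)
  qed (auto intro!: absolutely_integrable_imp_integrable azz' aR)
  also have "\<dots> = integral {s..t} R"
    by (rule lebesgue_integral_eq_integral) (auto intro!: absolutely_integrable_imp_integrable aR)
  also have "\<dots> = integral {s..t} (\<lambda>r. z r \<bullet> h r + energy E w p (x r - z r)) - integral {s..t} (\<lambda>r. energy E w p (x r))"
    unfolding R_def
    by (intro Henstock_Kurzweil_Integration.integral_diff integrable_add
        set_lebesgue_integral_eq_integral(1)[OF izh] integrable_continuous_real en)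
  finally show ?thesis by (simp add: z_def)
qed

section \<open>Decay for zero data\<close>

lemma zero_data_decay:
  assumes G: "hypergraph E w" and p: "1 \<le> p"
    and c: "0 < c" "\<And>z. (\<And>j. z $ Inr j = 0) \<Longrightarrow> c * norm z powr p \<le> energy E w p z"
    and sol: "global_solution E w p (\<lambda>t. 0) (\<lambda>t. 0) x\<^sub>0 x" and st: "0 \<le> s" "s \<le> t"
  shows "(norm (x t))\<^sup>2 + 2 * c * (t - s) * norm (x t) powr p \<le> (norm (x s))\<^sup>2"
proof -
  have x: "continuous_on {0..} x" using sol by (auto simp: global_solution_def W12_loc_def)
  have eq: "x r - free_part (x r) = 0" if "0 < r" for r
    using global_solution_constraint[OF sol _ _ that] by simp
  have zero: "x r $ Inr j = 0" if "0 < r" for r j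
    using arg_cong[OF eq[OF that], of "\<lambda>v. v $ Inr j"] by simp
  have en: "continuous_on {s..t} (\<lambda>r. energy E w p (x r))" if "0 < s" for s t
    using that by (intro continuous_on_energy[OF G p] continuous_on_subset[OF x]) auto
  have ei: "(norm (x t))\<^sup>2 / 2 + integral {s..t} (\<lambda>r. energy E w p (x r)) \<le> (norm (x s))\<^sup>2 / 2"
    if st: "0 < s" "s \<le> t" for s t
  proof -
    have "integral {s..t} (\<lambda>r. free_part (x r) \<bullet> 0 + energy E w p (x r - free_part (x r)))
        = integral {s..t} (\<lambda>r. 0)"
      using st by (intro Henstock_Kurzweil_Integration.integral_cong) (simp add: eq energy_zero[OF G])
    then show ?thesis
      using global_solution_energy_inequality[OF G p sol st] eq[of s] eq[of t] st
      by (simp add: absolutely_integrable_on_def)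
  qed
  have mono: "norm (x t) \<le> norm (x r)" if "0 < r" "r \<le> t" for r
  proof -
    have "0 \<le> integral {r..t} (\<lambda>r. energy E w p (x r))"
      using that en by (intro Henstock_Kurzweil_Integration.integral_nonneg integrable_continuous_real
          energy_nonneg[OF G p]) auto
    then have "(norm (x t))\<^sup>2 \<le> (norm (x r))\<^sup>2" using ei[OF that] by linarith
    then show ?thesis by (rule power2_le_imp_le) simp
  qed
  have pos: "(norm (x t))\<^sup>2 + 2 * c * (t - s) * norm (x t) powr p \<le> (norm (x s))\<^sup>2"
    if st: "0 < s" "s \<le> t" for s
  proof -
    have "(t - s) * (c * norm (x t) powr p) = integral {s..t} (\<lambda>r. c * norm (x t) powr p)"
      using st by simp
    also have "\<dots> \<le> integral {s..t} (\<lambda>r. energy E w p (x r))"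
    proof (rule integral_le)
      show "(\<lambda>r. energy E w p (x r)) integrable_on {s..t}"
        using st by (intro integrable_continuous_real en)
      fix r assume r: "r \<in> {s..t}"
      have "c * norm (x t) powr p \<le> c * norm (x r) powr p"
        using c(1) p r st by (intro mult_left_mono powr_mono2 mono) auto
      also have "\<dots> \<le> energy E w p (x r)" using r st by (intro c(2) zero) auto
      finally show "c * norm (x t) powr p \<le> energy E w p (x r)" .
    qed (auto intro!: integrable_continuous_real continuous_on_const)
    finally show ?thesis using ei[OF st] by (simp add: algebra_simps)
  qed
  \<comment> \<open>The case \<open>s = 0\<close> follows by continuity of the solution at the initial time.\<close>
  show ?thesis
  proof (cases "s = 0 \<and> 0 < t")
    case False
    with st have "0 < s \<or> s = t" by auto
    then show ?thesis using pos[OF _ st(2)] by auto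
  next
    case True
    have "((\<lambda>r. (norm (x t))\<^sup>2 + 2 * c * (t - r) * norm (x t) powr p - (norm (x r))\<^sup>2) \<longlongrightarrow>
        (norm (x t))\<^sup>2 + 2 * c * (t - 0) * norm (x t) powr p - (norm (x 0))\<^sup>2) (at_right 0)"
    proof (intro tendsto_intros)
      have "(x \<longlongrightarrow> x 0) (at 0 within {0..})" using x by (simp add: continuous_on_def)
      then show "(x \<longlongrightarrow> x 0) (at_right 0)" by (rule tendsto_within_subset) auto
    qed
    moreover have "\<forall>\<^sub>F r in at_right 0.
        (norm (x t))\<^sup>2 + 2 * c * (t - r) * norm (x t) powr p - (norm (x r))\<^sup>2 \<le> 0"
      using True pos by (auto simp: eventually_at_right_field intro!: exI[of _ t])
    ultimately have "(norm (x t))\<^sup>2 + 2 * c * (t - 0) * norm (x t) powr p - (norm (x 0))\<^sup>2 \<le> 0"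
      by (rule tendsto_upperbound) simp
    then show ?thesis using True by simp
  qed
qed

section \<open>Convergence to zero\<close>

lemma Lspace_1_imp_absolutely_integrable:
  "f \<in> Lspace 1 S \<Longrightarrow> S \<in> sets lebesgue \<Longrightarrow> f absolutely_integrable_on S"
  by (simp add: Lspace_def absolutely_integrable_measurable o_def)

lemma tail_integral_bounds:
  fixes f :: "real \<Rightarrow> real"
  assumes f: "f integrable_on {0<..}" and nonneg: "\<And>r. 0 \<le> f r" and "0 < s"
  shows "f integrable_on {s..t}" "integral {s..t} f \<le> integral {0<..} f"
proof -
  have "{s..t} \<subseteq> {0<..}" using \<open>0 < s\<close> by auto
  moreover have "f absolutely_integrable_on {0<..}"
    using f nonneg by (simp add: absolutely_integrable_on_iff_nonneg)
  ultimately show i: "f integrable_on {s..t}"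
    using set_integrable_subset[of lebesgue "{0<..}" f "{s..t}"] set_lebesgue_integral_eq_integral(1)
    by auto
  show "integral {s..t} f \<le> integral {0<..} f"
    using \<open>0 < s\<close> nonneg by (intro integral_subset_le i f) auto
qed

lemma integrable_powr_and_derivative_imp_tendsto_zero:
  fixes a a' :: "real \<Rightarrow> 'a::euclidean_space"
  assumes p: "0 < p" and cont: "continuous_on {0..} a" and wd: "has_weak_derivative a a'"
    and a': "(\<lambda>t. norm (a' t)) integrable_on {0<..}"
    and a: "(\<lambda>t. norm (a t) powr p) integrable_on {0<..}"
  shows "(a \<longlongrightarrow> 0) at_top"
proof -
  define G where "G t = integral {1..t} (\<lambda>r. norm (a' r))" for t
  have G: "G t - G s = integral {s..t} (\<lambda>r. norm (a' r))" if "1 \<le> s" "s \<le> t" for s t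
    using Henstock_Kurzweil_Integration.integral_combine[OF that tail_integral_bounds(1)[OF a']]
    by (simp add: G_def algebra_simps)
  have "((\<lambda>t. norm (a t)) \<longlongrightarrow> 0) at_top"
  proof (rule tendsto_zero_if_integrable_and_increments_bounded[OF p, where G=G])
    show "continuous_on {1..} (\<lambda>t. norm (a t))"
      by (intro continuous_intros continuous_on_subset[OF cont]) auto
    show "integral {1..t} (\<lambda>r. norm (a r) powr p) \<le> integral {0<..} (\<lambda>r. norm (a r) powr p)" for t
      by (rule tail_integral_bounds(2)[OF a]) auto
    show "G t \<le> integral {0<..} (\<lambda>r. norm (a' r))" for t
      unfolding G_def by (rule tail_integral_bounds(2)[OF a']) auto
    fix s t :: real assume st: "1 \<le> s" "s \<le> t"
    have i: "(\<lambda>r. norm (a' r)) integrable_on {s..t}"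
      using st by (intro tail_integral_bounds(1)[OF a']) auto
    have "0 \<le> integral {s..t} (\<lambda>r. norm (a' r))"
      by (rule Henstock_Kurzweil_Integration.integral_nonneg[OF i]) simp
    then show "G s \<le> G t" using G[OF st] by simp
    have "a' integrable_on {s..t}"
      using has_weak_derivative_imp_absolutely_integrable[OF wd, of s t] st set_lebesgue_integral_eq_integral(1)
      by fastforce
    then have "norm (integral {s..t} a') \<le> integral {s..t} (\<lambda>r. norm (a' r))"
      using i by (intro integral_norm_bound_integral) auto
    moreover have "norm (a t) \<le> norm (a s) + norm (a t - a s)" by (rule norm_triangle_sub)
    ultimately show "norm (a t) \<le> norm (a s) + (G t - G s)"
      using weak_derivative_fundamental_theorem[OF wd cont, of s t] G[OF st] st by simp
  qed auto
  then show ?thesis by (rule tendsto_norm_zero_cancel)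
qed

text \<open>The free part \<open>z\<close> of the solution is bounded by the energy inequality; then the energy has a finite
  integral, hence so has the \<open>p\<close>-th power of \<open>norm z\<close>, and the increments of \<open>(norm z)\<^sup>2\<close> are bounded by those of
  the integral of an integrable function.  The initial time \<open>1\<close> is an arbitrary positive number.\<close>

lemma global_solution_tendsto_zero:
  fixes a h :: "real \<Rightarrow> real ^ ('n::finite + 'm::finite)"
  assumes G: "hypergraph E w" and conn: "hypergraph_connected E" and p: "1 \<le> p"
    and sol: "global_solution E w p a h x\<^sub>0 x"
    and ac: "continuous_on {0..} a" and a0: "\<forall>t\<ge>0. \<forall>i. a t $ Inl i = 0"
    and h: "h absolutely_integrable_on {0<..}"
    and a: "(\<lambda>t. norm (a t) powr p) integrable_on {0<..}" and alim: "(a \<longlongrightarrow> 0) at_top"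
  shows "(x \<longlongrightarrow> 0) at_top"
proof -
  let ?\<phi> = "energy E w p"
  have x: "continuous_on {0..} x" using sol by (auto simp: global_solution_def W12_loc_def)
  interpret F: bounded_linear free_part by (rule bounded_linear_free_part)
  define z where "z r = free_part (x r)" for r
  have zc: "continuous_on {0..} z" unfolding z_def by (rule F.continuous_on[OF x])
  have xz: "x r - z r = a r" if "0 < r" for r
    using global_solution_constraint[OF sol ac a0 that] by (simp add: z_def)
  obtain c where c: "0 < c" "\<And>v. (\<And>j. v $ Inr j = 0) \<Longrightarrow> c * norm v powr p \<le> ?\<phi> v"
    using energy_ge_norm_powr[OF G conn p] by metis
  obtain C where C: "0 \<le> C" "\<And>v. ?\<phi> v \<le> C * norm v powr p"
    using energy_le_norm_powr[OF G p] by metis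
  define H where "H = integral {0<..} (\<lambda>r. norm (h r))"
  define A where "A = C * integral {0<..} (\<lambda>r. norm (a r) powr p)"
  have nh: "(\<lambda>r. norm (h r)) integrable_on {0<..}"
    using h absolutely_integrable_on_def by blast
  have Hi: "(\<lambda>r. norm (h r)) integrable_on {s..t}" "integral {s..t} (\<lambda>r. norm (h r)) \<le> H" if "1 \<le> s" for s t
    unfolding H_def using that by (auto intro!: tail_integral_bounds[OF nh])
  have sub: "continuous_on {s..t} x" "continuous_on {s..t} z" "continuous_on {s..t} a" if "1 \<le> s" for s t
    using that by (auto intro!: continuous_on_subset[OF x] continuous_on_subset[OF zc] continuous_on_subset[OF ac])
  have \<phi>a: "(\<lambda>r. ?\<phi> (a r)) integrable_on {s..t}" "(\<lambda>r. ?\<phi> (x r)) integrable_on {s..t}"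
    "(\<lambda>r. ?\<phi> (z r)) integrable_on {s..t}" if "1 \<le> s" for s t
    using sub[OF that] by (auto intro!: integrable_continuous_real continuous_on_energy[OF G p])
  have Ai: "integral {s..t} (\<lambda>r. ?\<phi> (a r)) \<le> A" if "1 \<le> s" for s t
  proof -
    have i: "(\<lambda>r. norm (a r) powr p) integrable_on {s..t}"
      "integral {s..t} (\<lambda>r. norm (a r) powr p) \<le> integral {0<..} (\<lambda>r. norm (a r) powr p)"
      using that by (auto intro!: tail_integral_bounds[OF a])
    have "integral {s..t} (\<lambda>r. ?\<phi> (a r)) \<le> integral {s..t} (\<lambda>r. C * norm (a r) powr p)"
      using C(2) integrable_cmul[OF i(1), of C] by (intro integral_le \<phi>a that) auto
    also have "\<dots> = C * integral {s..t} (\<lambda>r. norm (a r) powr p)" by simp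
    also have "\<dots> \<le> A" unfolding A_def using i(2) C(1) by (rule mult_left_mono)
    finally show ?thesis .
  qed
  have EI: "(norm (z t))\<^sup>2 / 2 + integral {s..t} (\<lambda>r. ?\<phi> (x r))
      \<le> (norm (z s))\<^sup>2 / 2 + integral {s..t} (\<lambda>r. K * norm (h r) + ?\<phi> (a r))"
    if st: "1 \<le> s" "s \<le> t" and K: "\<And>r. r \<in> {s..t} \<Longrightarrow> norm (z r) \<le> K" for s t K
  proof -
    have hst: "h absolutely_integrable_on {s..t}"
      by (rule set_integrable_subset[OF h]) (use st in auto)
    have zh: "(\<lambda>r. z r \<bullet> h r) integrable_on {s..t}"
      using absolutely_integrable_inner_continuous[OF sub(2)[OF st(1)] hst]
      by (rule set_lebesgue_integral_eq_integral(1))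
    have "integral {s..t} (\<lambda>r. z r \<bullet> h r + ?\<phi> (x r - z r)) = integral {s..t} (\<lambda>r. z r \<bullet> h r + ?\<phi> (a r))"
      using st by (intro Henstock_Kurzweil_Integration.integral_cong) (simp add: xz)
    also have "\<dots> \<le> integral {s..t} (\<lambda>r. K * norm (h r) + ?\<phi> (a r))"
    proof (rule integral_le)
      show "(\<lambda>r. z r \<bullet> h r + ?\<phi> (a r)) integrable_on {s..t}"
        by (intro integrable_add zh \<phi>a st)
      show "(\<lambda>r. K * norm (h r) + ?\<phi> (a r)) integrable_on {s..t}"
        using integrable_add[OF integrable_cmul[OF Hi(1)[OF st(1)], of K] \<phi>a(1)[OF st(1)]] by simp
      fix r assume "r \<in> {s..t}"
      then have "norm (z r) * norm (h r) \<le> K * norm (h r)"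
        using K by (intro mult_right_mono) auto
      then show "z r \<bullet> h r + ?\<phi> (a r) \<le> K * norm (h r) + ?\<phi> (a r)"
        using norm_cauchy_schwarz[of "z r" "h r"] by linarith
    qed
    finally show ?thesis
      using global_solution_energy_inequality[OF G p sol _ st(2) hst] st by (simp add: z_def)
  qed
  have split: "integral {s..t} (\<lambda>r. K * norm (h r) + ?\<phi> (a r))
      = K * integral {s..t} (\<lambda>r. norm (h r)) + integral {s..t} (\<lambda>r. ?\<phi> (a r))" if "1 \<le> s" for s t K
    using Henstock_Kurzweil_Integration.integral_add
      [OF integrable_cmul[OF Hi(1)[OF that], of K] \<phi>a(1)[OF that]] by simp
  have split_le: "integral {s..t} (\<lambda>r. K * norm (h r) + ?\<phi> (a r)) \<le> K * H + A"
    if "1 \<le> s" "0 \<le> K" for s t K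
    unfolding split[OF that(1)] using that Hi Ai by (intro add_mono mult_left_mono) auto
  have \<phi>0: "0 \<le> integral {s..t} (\<lambda>r. ?\<phi> (x r))" "0 \<le> integral {s..t} (\<lambda>r. ?\<phi> (a r))" if "1 \<le> s" for s t
    using \<phi>a[OF that] energy_nonneg[OF G p]
    by (auto intro!: Henstock_Kurzweil_Integration.integral_nonneg)
  have H0: "0 \<le> H" unfolding H_def using nh by (intro Henstock_Kurzweil_Integration.integral_nonneg) auto
  have A0: "0 \<le> A" using Ai[of 1 1] by simp
  define M where "M = (norm (z 1))\<^sup>2 + 2 * H + 2 * A + 1"
  have M0: "1 \<le> M" using H0 A0 by (simp add: M_def)
  have M: "norm (z t) \<le> M" if t: "1 \<le> t" for t
  proof -
    have "continuous_on {1..t} (\<lambda>r. norm (z r))" by (intro continuous_intros sub) auto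
    then obtain m where m: "m \<in> {1..t}" "\<And>r. r \<in> {1..t} \<Longrightarrow> norm (z r) \<le> norm (z m)"
      using continuous_attains_sup[of "{1..t}" "\<lambda>r. norm (z r)"] t by auto
    let ?K = "norm (z m)"
    \<comment> \<open>At the time \<open>m\<close> of the maximum the energy inequality becomes quadratic in the maximum.\<close>
    have "?K\<^sup>2 / 2 + integral {1..m} (\<lambda>r. ?\<phi> (x r))
        \<le> (norm (z 1))\<^sup>2 / 2 + integral {1..m} (\<lambda>r. ?K * norm (h r) + ?\<phi> (a r))"
      using m by (intro EI) auto
    also have "\<dots> \<le> (norm (z 1))\<^sup>2 / 2 + (?K * H + A)" using split_le[of 1 ?K m] by simp
    finally have K: "?K\<^sup>2 \<le> (norm (z 1))\<^sup>2 + 2 * ?K * H + 2 * A"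
      using \<phi>0(1)[of 1 m] by (simp add: field_simps)
    have "?K \<le> M"
    proof (cases "?K \<le> 1")
      case False
      have "(norm (z 1))\<^sup>2 \<le> ?K * (norm (z 1))\<^sup>2" "2 * A \<le> ?K * (2 * A)"
        using False A0 mult_right_mono[of 1 ?K "(norm (z 1))\<^sup>2"] mult_right_mono[of 1 ?K "2 * A"] by auto
      then have "?K * ?K \<le> ?K * ((norm (z 1))\<^sup>2 + 2 * H + 2 * A)"
        using K by (simp add: power2_eq_square algebra_simps)
      then have "?K \<le> (norm (z 1))\<^sup>2 + 2 * H + 2 * A" using False
        by (intro mult_left_le_imp_le[of ?K ?K]) auto
      then show ?thesis by (simp add: M_def)
    qed (use M0 in simp)
    then show ?thesis using m(2)[of t] t by simp
  qed
  define W where "W t = 2 * integral {1..t} (\<lambda>r. M * norm (h r) + ?\<phi> (a r))" for t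
  have fin: "(\<lambda>r. M * norm (h r) + ?\<phi> (a r)) integrable_on {s..t}" if "1 \<le> s" for s t
    using integrable_add[OF integrable_cmul[OF Hi(1)[OF that], of M] \<phi>a(1)[OF that]] by simp
  have W: "W t - W s = 2 * integral {s..t} (\<lambda>r. M * norm (h r) + ?\<phi> (a r))" if "1 \<le> s" "s \<le> t" for s t
    using Henstock_Kurzweil_Integration.integral_combine[OF that fin] by (simp add: W_def)
  have zlim2: "((\<lambda>t. (norm (z t))\<^sup>2) \<longlongrightarrow> 0) at_top"
  proof (rule tendsto_zero_if_integrable_and_increments_bounded[where G=W and q="p / 2"])
    show "continuous_on {1..} (\<lambda>t. (norm (z t))\<^sup>2)"
      by (intro continuous_intros continuous_on_subset[OF zc]) auto
    show "W t \<le> 2 * (M * H + A)" if "1 \<le> t" for t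
      using split_le[of 1 M t] M0 by (simp add: W_def)
    show "integral {1..t} (\<lambda>r. (norm (z r))\<^sup>2 powr (p / 2))
        \<le> 2 powr p / c * ((norm (z 1))\<^sup>2 / 2 + (M * H + A) + A)" if t: "1 \<le> t" for t
    proof -
      have pw: "(norm (z r))\<^sup>2 powr (p / 2) \<le> 2 powr p / c * (?\<phi> (x r) + ?\<phi> (a r))" if "r \<in> {1..t}" for r
      proof -
        have "(norm (z r))\<^sup>2 powr (p / 2) = norm (z r) powr p"
          by (simp add: powr_powr flip: powr_numeral)
        moreover have "c * norm (z r) powr p \<le> ?\<phi> (z r)" by (rule c(2)) (simp add: z_def)
        moreover have "?\<phi> (z r) \<le> 2 powr p * (?\<phi> (x r) + ?\<phi> (a r))"
          using energy_diff_le[OF G p, of "x r" "a r"] xz[of r] that by (simp add: algebra_simps)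
        ultimately show ?thesis using c(1) by (simp add: field_simps)
      qed
      have "integral {1..t} (\<lambda>r. (norm (z r))\<^sup>2 powr (p / 2))
          \<le> integral {1..t} (\<lambda>r. 2 powr p / c * (?\<phi> (x r) + ?\<phi> (a r)))"
      proof (rule integral_le[OF _ _ pw])
        show "(\<lambda>r. (norm (z r))\<^sup>2 powr (p / 2)) integrable_on {1..t}"
          using p by (intro integrable_continuous_real continuous_on_powr' continuous_intros sub) auto
        show "(\<lambda>r. 2 powr p / c * (?\<phi> (x r) + ?\<phi> (a r))) integrable_on {1..t}"
          by (intro integrable_continuous_real continuous_intros continuous_on_energy[OF G p] sub) auto
      qed
      also have "\<dots> = 2 powr p / c * (integral {1..t} (\<lambda>r. ?\<phi> (x r)) + integral {1..t} (\<lambda>r. ?\<phi> (a r)))"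
        by (simp add: Henstock_Kurzweil_Integration.integral_add \<phi>a)
      also have "\<dots> \<le> 2 powr p / c * ((norm (z 1))\<^sup>2 / 2 + (M * H + A) + A)"
      proof (intro mult_left_mono add_mono Ai)
        have "(norm (z t))\<^sup>2 / 2 + integral {1..t} (\<lambda>r. ?\<phi> (x r))
          \<le> (norm (z 1))\<^sup>2 / 2 + integral {1..t} (\<lambda>r. M * norm (h r) + ?\<phi> (a r))"
          using t M by (intro EI) auto
        also have "\<dots> \<le> (norm (z 1))\<^sup>2 / 2 + (M * H + A)" using split_le[of 1 M t] M0 by simp
        finally show "integral {1..t} (\<lambda>r. ?\<phi> (x r)) \<le> (norm (z 1))\<^sup>2 / 2 + (M * H + A)"
          using zero_le_power2[of "norm (z t)"] by linarith
      qed (use c in auto)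
      finally show ?thesis .
    qed
    fix s t :: real assume st: "1 \<le> s" "s \<le> t"
    have "0 \<le> integral {s..t} (\<lambda>r. M * norm (h r) + ?\<phi> (a r))"
      using fin[OF st(1)] M0 energy_nonneg[OF G p]
      by (intro Henstock_Kurzweil_Integration.integral_nonneg) auto
    then show "W s \<le> W t" using W[OF st] by simp
    have "(norm (z t))\<^sup>2 / 2 + integral {s..t} (\<lambda>r. ?\<phi> (x r))
          \<le> (norm (z s))\<^sup>2 / 2 + integral {s..t} (\<lambda>r. M * norm (h r) + ?\<phi> (a r))"
      using st M by (intro EI) auto
    then show "(norm (z t))\<^sup>2 \<le> (norm (z s))\<^sup>2 + (W t - W s)"
      using W[OF st] \<phi>0(1)[OF st(1), of t] by simp
  qed (use p in auto)
  have "((\<lambda>t. norm (z t)) \<longlongrightarrow> 0) at_top"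
    using tendsto_real_sqrt[OF zlim2] by simp
  then have "(z \<longlongrightarrow> 0) at_top" by (rule tendsto_norm_zero_cancel)
  from tendsto_add[OF this alim] have "((\<lambda>t. z t + a t) \<longlongrightarrow> 0) at_top" by simp
  moreover have "\<forall>\<^sub>F t in at_top. z t + a t = x t"
    using eventually_gt_at_top[of 0] by eventually_elim (simp add: xz[symmetric])
  ultimately show ?thesis by (rule Lim_transform_eventually)
qed

section \<open>The decay theorem\<close>

theorem theorem5p3:
  fixes E :: "('n::finite + 'm::finite) set set"
    and w :: "('n + 'm) set \<Rightarrow> real"
    and p :: real
  assumes "hypergraph E w"
    and "hypergraph_connected E"
    and "1 \<le> p"
  shows
    "(\<forall>(a :: real \<Rightarrow> real ^ ('n + 'm)) a' h h' x\<^sub>0 x.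
        (\<forall>t\<ge>0. \<forall>i. a t $ Inl i = 0) \<longrightarrow>
        a \<in> W12_loc \<longrightarrow> h \<in> Lspace_loc 2 \<longrightarrow>
        has_weak_derivative a a' \<longrightarrow> has_weak_derivative h h' \<longrightarrow>
        a' \<in> Lspace 1 {0<..} \<longrightarrow> h' \<in> Lspace 1 {0<..} \<longrightarrow>
        h \<in> Lspace 1 {0<..} \<inter> Lspace 2 {0<..} \<longrightarrow>
        x\<^sub>0 \<in> constraint_set a 0 \<longrightarrow>
        global_solution E w p a h x\<^sub>0 x \<longrightarrow>
        a \<in> Lspace p {0<..} \<longrightarrow> a' \<in> Lspace 2 {0<..} \<longrightarrow>
        (x \<longlongrightarrow> 0) at_top) \<and>
     (\<exists>\<gamma>>0. \<forall>(x\<^sub>0 :: real ^ ('n + 'm)) x.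
        x\<^sub>0 \<in> constraint_set (\<lambda>t. 0) 0 \<longrightarrow>
        global_solution E w p (\<lambda>t. 0) (\<lambda>t. 0) x\<^sub>0 x \<longrightarrow>
        (\<forall>t\<ge>0. norm (x t) \<le>
           (if p < 2 then (max 0 (norm x\<^sub>0 powr (2 - p) - \<gamma> * t)) powr (1 / (2 - p))
            else if p = 2 then norm x\<^sub>0 * exp (- \<gamma> * t)
            else if x\<^sub>0 = 0 then 0
            else (norm x\<^sub>0 powr (- (p - 2)) + \<gamma> * t) powr (- (1 / (p - 2))))))"
proof (intro conjI allI impI)
  fix a a' h h' :: "real \<Rightarrow> real ^ ('n + 'm)" and x\<^sub>0 x
  assume a0: "\<forall>t\<ge>0. \<forall>i. a t $ Inl i = 0"
    and a: "a \<in> W12_loc" "has_weak_derivative a a'" "a' \<in> Lspace 1 {0<..}" "a \<in> Lspace p {0<..}"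
    and h: "h \<in> Lspace 1 {0<..} \<inter> Lspace 2 {0<..}"
    and sol: "global_solution E w p a h x\<^sub>0 x"
  have ac: "continuous_on {0..} a" using a(1) by (simp add: W12_loc_def)
  have ap: "(\<lambda>t. norm (a t) powr p) integrable_on {0<..}"
    using a(4) by (auto simp: Lspace_def intro: integrable_on_lebesgue_on)
  have "(\<lambda>t. norm (a' t)) integrable_on {0<..}"
    using Lspace_1_imp_absolutely_integrable[OF a(3)] by (auto simp: absolutely_integrable_on_def)
  then have "(a \<longlongrightarrow> 0) at_top"
    using assms(3) by (intro integrable_powr_and_derivative_imp_tendsto_zero[OF _ ac a(2) _ ap]) auto
  moreover have "h absolutely_integrable_on {0<..}"
    using h Lspace_1_imp_absolutely_integrable[of h "{0<..}"] by simp
  ultimately show "(x \<longlongrightarrow> 0) at_top"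
    by (intro global_solution_tendsto_zero[OF assms sol ac a0 _ ap])
next
  obtain c where c: "0 < c" "\<And>z. (\<And>j. z $ Inr j = 0) \<Longrightarrow> c * norm z powr p \<le> energy E w p z"
    using energy_ge_norm_powr[OF assms] by metis
  \<comment> \<open>The rate depends on the hypergraph only through the Poincare constant \<open>c\<close>.\<close>
  define \<gamma> where "\<gamma> = (if p = 2 then 1 else \<bar>2 - p\<bar>) * (2 powr (1 - p) * (2 * c / 3))"
  have "0 < \<gamma>" using c(1) by (simp add: \<gamma>_def)
  moreover have "norm (x t) \<le>
           (if p < 2 then (max 0 (norm x\<^sub>0 powr (2 - p) - \<gamma> * t)) powr (1 / (2 - p))
            else if p = 2 then norm x\<^sub>0 * exp (- \<gamma> * t)
            else if x\<^sub>0 = 0 then 0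
            else (norm x\<^sub>0 powr (- (p - 2)) + \<gamma> * t) powr (- (1 / (p - 2))))"
    if sol: "global_solution E w p (\<lambda>t. 0) (\<lambda>t. 0) x\<^sub>0 x" and t: "0 \<le> t" for x\<^sub>0 x t
  proof -
    have x: "continuous_on {0..} x" "x 0 = x\<^sub>0"
      using sol by (auto simp: global_solution_def W12_loc_def)
    have decay: "(norm (x t))\<^sup>2 + 2 * c * (t - s) * norm (x t) powr p \<le> (norm (x s))\<^sup>2"
      if "0 \<le> s" "s \<le> t" for s t
      using zero_data_decay[OF assms(1,3) c sol that] .
    show ?thesis
      using power_law_decay[where y="\<lambda>t. norm (x t)",
          OF c(1) assms(3) t continuous_on_norm[OF x(1)] norm_ge_zero decay \<gamma>_def]
      unfolding x(2) norm_eq_zero .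
  qed
  ultimately show "\<exists>\<gamma>>0. \<forall>(x\<^sub>0 :: real ^ ('n + 'm)) x.
        x\<^sub>0 \<in> constraint_set (\<lambda>t. 0) 0 \<longrightarrow>
        global_solution E w p (\<lambda>t. 0) (\<lambda>t. 0) x\<^sub>0 x \<longrightarrow>
        (\<forall>t\<ge>0. norm (x t) \<le>
           (if p < 2 then (max 0 (norm x\<^sub>0 powr (2 - p) - \<gamma> * t)) powr (1 / (2 - p))
            else if p = 2 then norm x\<^sub>0 * exp (- \<gamma> * t)
            else if x\<^sub>0 = 0 then 0
            else (norm x\<^sub>0 powr (- (p - 2)) + \<gamma> * t) powr (- (1 / (p - 2)))))"
    by blast
qed

end
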